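(* It holds that $$\lim_{j\to\infty}\frac{|\lambda_j|^{1/2}}{\mu_j^{1/2}}=\lim_{j\to\infty}\frac{|\lambda_j|^{1/2}}{\|\phi_j\|_V}=1.$$ If moreover $2\alpha+\gamma>\frac32$ in case $\alpha\le1$ (respectively $2\alpha+\gamma>1$ in case $\alpha>1$), then the sequence $\{\phi_j/\|\phi_j\|_V\}_{j=1}^\infty$ is quadratically close to the sequence $\{\psi_j/\mu_j^{1/2}\}_{j=1}^\infty$ in the $V$-norm, i.e. $\sum_{j}\big\|\phi_j/\|\phi_j\|_V-\psi_j/\mu_j^{1/2}\big\|_V^2<\infty$.
   Context: $H$ is a separable infinite-dimensional complex Hilbert space with inner product $(\cdot,\cdot)$ and norm $\|\cdot\|$. $a$ is a closed, densely defined, Hermitian, positive-definite sesquilinear form with domain $V\subset H$, and $A$ is the associated self-adjoint operator: $V=D(A^{1/2})$, $a(u,v)=(A^{1/2}u,A^{1/2}v)$, $\|u\|_V=\|A^{1/2}u\|$. $A$ has compact resolvent, with eigenvalues $0<\mu_1\le\mu_2\le\dots$ (with multiplicity) and an orthonormal basis of eigenvectors $\psi_k$ of $H$. $b$ is a sesquilinear form on $V$ (continuous in the $V$-norm, hence determined by the values $b(\psi_m,\psi_n)$). Standing assumptions: there are $\gamma>0$, $\kappa>0$, $N_0>0$ with $\mu_{k+1}-\mu_k\ge\kappa k^{\gamma-1}$ for all $k\ge N_0$; and there are $\alpha\in\mathbb R$ with $2\alpha+\gamma>1$ and $M_b>0$ with $|b(\psi_m,\psi_n)|\le M_bm^{-\alpha}n^{-\alpha}$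 for all $m,n\in\mathbb N$. Then $t=a+b$ is a closed sectorial form on $V$ and $T$ denotes the associated m-sectorial operator; $T$ has compact resolvent. For all sufficiently large $n$, $n>N$, $T$ has exactly one eigenvalue $\lambda_n$ inside the positively oriented contour $\Gamma_n=\partial\Pi_n$, $\Pi_n=\{z\in\mathbb C:\mu_n-\frac\kappa2(n-1)^{\gamma-1}<\operatorname{Re}z<\mu_n+\frac\kappa2n^{\gamma-1},\ |\operatorname{Im}z|<\frac\kappa2n^{\gamma-1}\}$; it is algebraically simple, and $\phi_n=\frac1{2\pi i}\int_{\Gamma_n}(z-T)^{-1}\psi_n\,dz$ is a corresponding eigenvector. For $n\le N$ the $\phi_n$ are root vectors (generalized eigenvectors) forming a basis of the direct sum of the root subspaces of $T$ for the remaining eigenvalues. *)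

theory Defs
  imports "HOL-Analysis.Analysis"
begin

section \<open>Complex Hilbert spaces\<close>

text \<open>
  The inner product is linear in the first and antilinear in the second argument.
  The underlying real normed space carries the topology, so that limits and integrals of
  vector-valued functions are the ones of the library.
\<close>

class complex_hilbert_space = banach +
  fixes scaleC :: "complex \<Rightarrow> 'a \<Rightarrow> 'a"  (infixr \<open>*\<^sub>C\<close> 75)
    and cinner :: "'a \<Rightarrow> 'a \<Rightarrow> complex"
  assumes scaleC_add_right: "c *\<^sub>C (x + y) = c *\<^sub>C x + c *\<^sub>C y"
    and scaleC_add_left: "(c + d) *\<^sub>C x = c *\<^sub>C x + d *\<^sub>C x"
    and scaleC_scaleC: "c *\<^sub>C d *\<^sub>C x = (c * d) *\<^sub>C x"
    and scaleC_one: "1 *\<^sub>C x = x"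
    and scaleR_scaleC: "r *\<^sub>R x = complex_of_real r *\<^sub>C x"
    and cinner_commute: "cinner x y = cnj (cinner y x)"
    and cinner_add_left: "cinner (x + y) z = cinner x z + cinner y z"
    and cinner_scaleC_left: "cinner (c *\<^sub>C x) y = c * cinner x y"
    and cinner_ge_zero: "0 \<le> Re (cinner x x)"
    and cinner_eq_zero_iff: "cinner x x = 0 \<longleftrightarrow> x = 0"
    and norm_eq_sqrt_cinner: "norm x = sqrt (Re (cinner x x))"

global_interpretation complex_vector:
  vector_space "scaleC :: complex \<Rightarrow> 'a \<Rightarrow> 'a::complex_hilbert_space"
  defines csubspace = complex_vector.subspace
    and cspan = complex_vector.span
    and cdependent = complex_vector.dependent
    and cdim = complex_vector.dim
  by unfold_locales
    (rule scaleC_add_right scaleC_add_left scaleC_scaleC scaleC_one)+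

abbreviation cindependent :: "'a::complex_hilbert_space set \<Rightarrow> bool"
  where "cindependent B \<equiv> \<not> cdependent B"

text \<open>Sequences are indexed from \<open>1\<close>; the value at index \<open>0\<close> plays no role.\<close>

definition orthonormal_basis :: "(nat \<Rightarrow> 'a::complex_hilbert_space) \<Rightarrow> bool"
  where "orthonormal_basis \<psi> \<longleftrightarrow>
    (\<forall>m\<ge>1. \<forall>n\<ge>1. cinner (\<psi> m) (\<psi> n) = (if m = n then 1 else 0)) \<and>
    closure (cspan (\<psi> ` {1..})) = UNIV"


section \<open>Sesquilinear forms\<close>

text \<open>
  A form with domain \<open>V\<close> is a function on the whole type of which only the values on \<open>V\<close> are used.
\<close>

definition sesquilinear_on ::
    "'a::complex_hilbert_space set \<Rightarrow> ('a \<Rightarrow> 'a \<Rightarrow> complex) \<Rightarrow> bool"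
  where "sesquilinear_on V s \<longleftrightarrow> csubspace V \<and>
    (\<forall>u\<in>V. \<forall>v\<in>V. \<forall>w\<in>V. s (u + v) w = s u w + s v w \<and> s w (u + v) = s w u + s w v) \<and>
    (\<forall>c. \<forall>u\<in>V. \<forall>v\<in>V. s (c *\<^sub>C u) v = c * s u v \<and> s u (c *\<^sub>C v) = cnj c * s u v)"

definition hermitian_on :: "'a set \<Rightarrow> ('a \<Rightarrow> 'a \<Rightarrow> complex) \<Rightarrow> bool"
  where "hermitian_on V s \<longleftrightarrow> (\<forall>u\<in>V. \<forall>v\<in>V. s u v = cnj (s v u))"

definition positive_definite_on :: "'a::zero set \<Rightarrow> ('a \<Rightarrow> 'a \<Rightarrow> complex) \<Rightarrow> bool"
  where "positive_definite_on V s \<longleftrightarrow> (\<forall>u\<in>V. u \<noteq> 0 \<longrightarrow> 0 < Re (s u u))"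

text \<open>
  Closedness in the sense of Kato: if \<open>u\<^sub>n \<in> V\<close>, \<open>u\<^sub>n \<rightarrow> x\<close> in the Hilbert space and
  \<open>s[u\<^sub>n - u\<^sub>m] \<rightarrow> 0\<close>, then \<open>x \<in> V\<close> and \<open>s[u\<^sub>n - x] \<rightarrow> 0\<close>, where \<open>s[u] = s(u, u)\<close>.
\<close>

definition closed_form_on ::
    "'a::complex_hilbert_space set \<Rightarrow> ('a \<Rightarrow> 'a \<Rightarrow> complex) \<Rightarrow> bool"
  where "closed_form_on V s \<longleftrightarrow>
    (\<forall>u x. (\<forall>n. u n \<in> V) \<and> u \<longlonglongrightarrow> x \<and>
        (\<forall>e>0. \<exists>M::nat. \<forall>m\<ge>M. \<forall>n\<ge>M. cmod (s (u n - u m) (u n - u m)) < e)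
      \<longrightarrow> x \<in> V \<and> (\<lambda>n. s (u n - x) (u n - x)) \<longlonglongrightarrow> 0)"

text \<open>
  For a closed positive-definite Hermitian form \<open>a\<close> with associated operator \<open>A\<close> one has
  \<open>a(u, v) = (A\<^sup>1\<^sup>/\<^sup>2 u, A\<^sup>1\<^sup>/\<^sup>2 v)\<close> on \<open>V = D(A\<^sup>1\<^sup>/\<^sup>2)\<close>, hence this is
  \<open>\<parallel>u\<parallel>\<^sub>V = \<parallel>A\<^sup>1\<^sup>/\<^sup>2 u\<parallel>\<close>.
\<close>

definition form_norm :: "('a \<Rightarrow> 'a \<Rightarrow> complex) \<Rightarrow> 'a \<Rightarrow> real"
  where "form_norm a u = sqrt (Re (a u u))"

definition quadratically_close ::
    "('a::complex_hilbert_space \<Rightarrow> real) \<Rightarrow> (nat \<Rightarrow> 'a) \<Rightarrow> (nat \<Rightarrow> 'a) \<Rightarrow> bool"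
  where "quadratically_close \<nu> f g \<longleftrightarrow> (\<lambda>j. (\<nu> (f j - g j))\<^sup>2) summable_on {1..}"


section \<open>Unbounded operators\<close>

text \<open>Unbounded operators are represented by their graphs.\<close>

type_synonym 'a op_graph = "('a \<times> 'a) set"

text \<open>
  The operator associated with the form \<open>s\<close> on \<open>V\<close> by the first representation theorem:
  \<open>u \<in> D(S)\<close> and \<open>S u = w\<close> iff \<open>u \<in> V\<close> and \<open>s(u, v) = (w, v)\<close> for all \<open>v \<in> V\<close>.
  It is single-valued if \<open>V\<close> is dense.
\<close>

definition form_operator ::
    "'a::complex_hilbert_space set \<Rightarrow> ('a \<Rightarrow> 'a \<Rightarrow> complex) \<Rightarrow> 'a op_graph"
  where "form_operator V s = {(u, w). u \<in> V \<and> (\<forall>v\<in>V. s u v = cinner w v)}"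

definition resolvent :: "'a::complex_hilbert_space op_graph \<Rightarrow> complex \<Rightarrow> 'a \<Rightarrow> 'a"
  where "resolvent T z x = (THE u. \<exists>w. (u, w) \<in> T \<and> z *\<^sub>C u - w = x)"

definition resolvent_set :: "'a::complex_hilbert_space op_graph \<Rightarrow> complex set"
  where "resolvent_set T =
    {z. (\<forall>x. \<exists>!u. \<exists>w. (u, w) \<in> T \<and> z *\<^sub>C u - w = x) \<and> bounded_linear (resolvent T z)}"

definition compact_operator :: "('a::complex_hilbert_space \<Rightarrow> 'a) \<Rightarrow> bool"
  where "compact_operator R \<longleftrightarrow>
    Vector_Spaces.linear scaleC scaleC R \<and> (\<forall>S. bounded S \<longrightarrow> compact (closure (R ` S)))"

definition compact_resolvent :: "'a::complex_hilbert_space op_graph \<Rightarrow> bool"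
  where "compact_resolvent T \<longleftrightarrow> (\<exists>z\<in>resolvent_set T. compact_operator (resolvent T z))"

definition eigenvector :: "'a::complex_hilbert_space op_graph \<Rightarrow> complex \<Rightarrow> 'a \<Rightarrow> bool"
  where "eigenvector T z u \<longleftrightarrow> u \<noteq> 0 \<and> (u, z *\<^sub>C u) \<in> T"

definition eigenvalues :: "'a::complex_hilbert_space op_graph \<Rightarrow> complex set"
  where "eigenvalues T = {z. \<exists>u. eigenvector T z u}"

definition shift_op :: "'a::complex_hilbert_space op_graph \<Rightarrow> complex \<Rightarrow> 'a op_graph"
  where "shift_op T z = {(u, w - z *\<^sub>C u) | u w. (u, w) \<in> T}"

text \<open>
  The root subspace is the union over \<open>k\<close> of the kernels of \<open>(T - z)\<^sup>k\<close>; the power of a graph is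
  its \<open>k\<close>-fold relational composition, so the domain conditions are built in.
\<close>

definition root_subspace :: "'a::complex_hilbert_space op_graph \<Rightarrow> complex \<Rightarrow> 'a set"
  where "root_subspace T z = {u. \<exists>k::nat. (u, 0) \<in> shift_op T z ^^ k}"

definition algebraically_simple :: "'a::complex_hilbert_space op_graph \<Rightarrow> complex \<Rightarrow> bool"
  where "algebraically_simple T z \<longleftrightarrow> z \<in> eigenvalues T \<and> cdim (root_subspace T z) = 1"


section \<open>Contours and vector-valued contour integrals\<close>

text \<open>
  The vector-valued counterpart of the contour integral of the library (Henstock-Kurzweil
  integral over the parameter interval).
\<close>

definition vector_contour_integral ::
    "(real \<Rightarrow> complex) \<Rightarrow> (complex \<Rightarrow> 'a::complex_hilbert_space) \<Rightarrow> 'a"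
  where "vector_contour_integral g f =
    integral {0..1} (\<lambda>t. vector_derivative g (at t within {0..1}) *\<^sub>C f (g t))"

definition Pi_rect :: "(nat \<Rightarrow> real) \<Rightarrow> real \<Rightarrow> real \<Rightarrow> nat \<Rightarrow> complex set"
  where "Pi_rect \<mu> \<kappa> \<gamma> n =
    {z. \<mu> n - \<kappa> / 2 * (real n - 1) powr (\<gamma> - 1) < Re z \<and>
        Re z < \<mu> n + \<kappa> / 2 * real n powr (\<gamma> - 1) \<and>
        \<bar>Im z\<bar> < \<kappa> / 2 * real n powr (\<gamma> - 1)}"

text \<open>
  The boundary of the rectangle, given by its lower left and upper right corners; the library
  path \<^const>\<open>rectpath\<close> is positively oriented.
\<close>

definition Gamma_path :: "(nat \<Rightarrow> real) \<Rightarrow> real \<Rightarrow> real \<Rightarrow> nat \<Rightarrow> real \<Rightarrow> complex"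
  where "Gamma_path \<mu> \<kappa> \<gamma> n =
    rectpath
      (Complex (\<mu> n - \<kappa> / 2 * (real n - 1) powr (\<gamma> - 1)) (- (\<kappa> / 2 * real n powr (\<gamma> - 1))))
      (Complex (\<mu> n + \<kappa> / 2 * real n powr (\<gamma> - 1)) (\<kappa> / 2 * real n powr (\<gamma> - 1)))"

end

theory Submission
  imports Defs "HOL-Complex_Analysis.Winding_Numbers"
begin

text \<open>
  On the contour \<open>\<Gamma>\<^sub>n\<close> the coefficients \<open>u\<^sub>k\<close> of \<open>u = (z - T)\<^sup>-\<^sup>1 \<psi>\<^sub>n\<close> satisfy
  \<open>(z - \<mu>\<^sub>k) u\<^sub>k = \<delta>\<^sub>n\<^sub>k + b(u, \<psi>\<^sub>k)\<close> with \<open>\<bar>b(u, \<psi>\<^sub>k)\<bar> \<le> M k\<^sup>-\<^sup>\<alpha> S\<close>, \<open>S = \<Sum>\<^sub>m \<bar>u\<^sub>m\<bar> m\<^sup>-\<^sup>\<alpha>\<close>.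
  Inserting the first relation into the definition of \<open>S\<close> and using that
  \<open>\<Sum>\<^sub>k k\<^sup>-\<^sup>2\<^sup>\<alpha> / \<bar>z - \<mu>\<^sub>k\<bar>\<close> tends to \<open>0\<close> uniformly on \<open>\<Gamma>\<^sub>n\<close> gives \<open>S \<le> 2 n\<^sup>-\<^sup>\<alpha> / dist(\<mu>\<^sub>n, \<Gamma>\<^sub>n)\<close>
  for large \<open>n\<close>. Integrating over the contour, whose length is of order \<open>n\<^sup>\<gamma>\<^sup>-\<^sup>1\<close>, yields
  \<open>\<bar>(\<phi>\<^sub>n - \<psi>\<^sub>n, \<psi>\<^sub>k)\<bar> \<le> C n\<^sup>-\<^sup>\<alpha> k\<^sup>-\<^sup>\<alpha> / dist(\<mu>\<^sub>k, \<Gamma>\<^sub>n)\<close>, and the gap condition bounds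
  \<open>dist(\<mu>\<^sub>k, \<Gamma>\<^sub>n)\<close> from below by \<open>c (1 + \<bar>n - k\<bar>) max(n, k)\<^sup>\<gamma>\<^sup>-\<^sup>1\<close>. Hence \<open>\<parallel>\<phi>\<^sub>n - \<psi>\<^sub>n\<parallel>\<^sub>V / \<mu>\<^sub>n\<^sup>1\<^sup>/\<^sup>2\<close>
  tends to \<open>0\<close>, and it is square summable if \<open>2\<alpha> + \<gamma> > 3/2\<close>, which is automatic for \<open>\<alpha> > 1\<close>.
\<close>

section \<open>Sesquilinear forms and orthogonal expansions\<close>

lemma sesquilinear_on_diff:
  assumes s: "sesquilinear_on V s" and uvw: "u \<in> V" "v \<in> V" "w \<in> V"
  shows "s (u - v) w = s u w - s v w" "s w (u - v) = s w u - s w v"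
proof -
  have V: "csubspace V" using s by (simp add: sesquilinear_on_def)
  have d: "u - v \<in> V" by (rule complex_vector.subspace_diff[OF V uvw(1,2)])
  have "s ((u - v) + v) w = s (u - v) w + s v w" "s w ((u - v) + v) = s w (u - v) + s w v"
    using s d uvw unfolding sesquilinear_on_def by blast+
  then show "s (u - v) w = s u w - s v w" "s w (u - v) = s w u - s w v" by simp_all
qed

lemma sesquilinear_on_sum:
  assumes s: "sesquilinear_on V s" and w: "w \<in> V"
    and F: "finite F" "\<And>k. k \<in> F \<Longrightarrow> e k \<in> V"
  shows "s (\<Sum>k\<in>F. c k *\<^sub>C e k) w = (\<Sum>k\<in>F. c k * s (e k) w)"
    "s w (\<Sum>k\<in>F. c k *\<^sub>C e k) = (\<Sum>k\<in>F. cnj (c k) * s w (e k))"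
proof -
  have V: "csubspace V" using s by (simp add: sesquilinear_on_def)
  have 0: "s 0 w = 0" "s w 0 = 0"
    using sesquilinear_on_diff[OF s w w w] by simp_all
  have "s (\<Sum>k\<in>F. c k *\<^sub>C e k) w = (\<Sum>k\<in>F. c k * s (e k) w) \<and>
    s w (\<Sum>k\<in>F. c k *\<^sub>C e k) = (\<Sum>k\<in>F. cnj (c k) * s w (e k))"
    using F
  proof (induction F rule: finite_induct)
    case (insert k F)
    have "(\<Sum>k\<in>F. c k *\<^sub>C e k) \<in> V" "c k *\<^sub>C e k \<in> V" "e k \<in> V"
      using insert.prems V
      by (auto intro!: complex_vector.subspace_sum complex_vector.subspace_scale)
    then show ?case
      using insert s w unfolding sesquilinear_on_def by simp
  qed (simp add: 0)
  then show "s (\<Sum>k\<in>F. c k *\<^sub>C e k) w = (\<Sum>k\<in>F. c k * s (e k) w)"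
    "s w (\<Sum>k\<in>F. c k *\<^sub>C e k) = (\<Sum>k\<in>F. cnj (c k) * s w (e k))" by auto
qed

text \<open>Completing the square for a finite orthogonal system. One statement serves both the
  inner product (\<open>\<nu>\<close> constantly 1) and the form \<open>a\<close>
  (\<open>\<nu>\<close> the eigenvalues). The choice \<open>c = x\<close> gives Bessel's inequality,
  and for nonnegative \<open>\<nu>\<close> it minimises the distance.\<close>

lemma form_expansion:
  fixes s :: "'a::complex_hilbert_space \<Rightarrow> 'a \<Rightarrow> complex" and \<nu> :: "nat \<Rightarrow> real"
    and c x :: "nat \<Rightarrow> complex"
  assumes s: "sesquilinear_on V s" "hermitian_on V s" and u: "u \<in> V"
    and F: "finite F" "\<And>k. k \<in> F \<Longrightarrow> e k \<in> V"
    and orth: "\<And>j k. j \<in> F \<Longrightarrow> k \<in> F \<Longrightarrow> s (e j) (e k) = (if j = k then \<nu> k else 0)"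
    and x: "\<And>k. k \<in> F \<Longrightarrow> s u (e k) = \<nu> k * x k"
  defines "p \<equiv> (\<Sum>k\<in>F. c k *\<^sub>C e k)"
  shows "Re (s (u - p) (u - p)) = Re (s u u) - (\<Sum>k\<in>F. \<nu> k * (cmod (x k))\<^sup>2)
    + (\<Sum>k\<in>F. \<nu> k * (cmod (x k - c k))\<^sup>2)"
proof -
  have V: "csubspace V" using s by (simp add: sesquilinear_on_def)
  have p: "p \<in> V"
    unfolding p_def using F V
    by (auto intro!: complex_vector.subspace_sum complex_vector.subspace_scale)
  have up: "u - p \<in> V" by (rule complex_vector.subspace_diff[OF V u p])
  have sup: "s u p = (\<Sum>k\<in>F. cnj (c k) * (\<nu> k * x k))"
    unfolding p_def using sesquilinear_on_sum(2)[OF s(1) u F] x by simp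
  have spu: "s p u = cnj (s u p)" using s(2) u p unfolding hermitian_on_def by blast
  have "s (e j) p = cnj (c j) * \<nu> j" if "j \<in> F" for j
  proof -
    have "s (e j) p = (\<Sum>k\<in>F. cnj (c k) * s (e j) (e k))"
      unfolding p_def using sesquilinear_on_sum(2)[OF s(1) F(2)[OF that] F] by simp
    also have "\<dots> = (\<Sum>k\<in>F. if j = k then cnj (c k) * \<nu> k else 0)"
      by (intro sum.cong refl) (use orth that in auto)
    finally show ?thesis using F(1) that by simp
  qed
  then have spp: "s p p = (\<Sum>k\<in>F. c k * (cnj (c k) * \<nu> k))"
    by (subst p_def) (simp add: sesquilinear_on_sum(1)[OF s(1) p F])
  have "s (u - p) (u - p) = s u u - s u p - s p u + s p p"
    using sesquilinear_on_diff(1)[OF s(1) u p up] sesquilinear_on_diff(2)[OF s(1) u p u]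
      sesquilinear_on_diff(2)[OF s(1) u p p] by simp
  then have "Re (s (u - p) (u - p)) = Re (s u u) - 2 * Re (s u p) + Re (s p p)"
    by (simp add: spu)
  also have "\<dots> = Re (s u u) + (\<Sum>k\<in>F. Re (c k * (cnj (c k) * \<nu> k)) -
      2 * Re (cnj (c k) * (\<nu> k * x k)))"
    by (simp add: sup spp sum_subtractf sum_distrib_left)
  also have "(\<Sum>k\<in>F. Re (c k * (cnj (c k) * \<nu> k)) - 2 * Re (cnj (c k) * (\<nu> k * x k))) =
    (\<Sum>k\<in>F. \<nu> k * (cmod (x k - c k))\<^sup>2 - \<nu> k * (cmod (x k))\<^sup>2)"
    by (intro sum.cong refl)
      (simp add: cmod_power2, simp add: power2_eq_square algebra_simps)
  finally show ?thesis by (simp add: sum_subtractf)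
qed

section \<open>Bessel's identity and expansions in an orthonormal basis\<close>

lemma sesquilinear_on_cinner: "sesquilinear_on UNIV cinner"
proof -
  have add: "cinner w (u + v) = cinner w u + cinner w v" for u v w :: 'a
    by (subst (1 2 3) cinner_commute) (simp add: cinner_add_left)
  have scale: "cinner u (c *\<^sub>C v) = cnj c * cinner u v" for u v :: 'a and c
    by (subst (1 2) cinner_commute) (simp add: cinner_scaleC_left)
  show ?thesis
    by (simp add: sesquilinear_on_def add scale cinner_add_left cinner_scaleC_left)
qed

lemma hermitian_on_cinner: "hermitian_on UNIV cinner"
  unfolding hermitian_on_def using cinner_commute by blast

lemmas cinner_diff_left = sesquilinear_on_diff(1)[OF sesquilinear_on_cinner UNIV_I UNIV_I UNIV_I]

lemma cinner_zero_left: "cinner 0 y = 0"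
  using cinner_diff_left[of 0 0 y] by simp

lemma norm_power2_cinner: "(norm x)\<^sup>2 = Re (cinner x x)"
  by (simp add: norm_eq_sqrt_cinner cinner_ge_zero)

lemma orthonormal_basis_bessel:
  assumes "orthonormal_basis \<psi>" "finite F" "F \<subseteq> {1..}"
  shows "(norm (u - (\<Sum>k\<in>F. c k *\<^sub>C \<psi> k)))\<^sup>2 =
    (norm u)\<^sup>2 - (\<Sum>k\<in>F. (cmod (cinner u (\<psi> k)))\<^sup>2) + (\<Sum>k\<in>F. (cmod (cinner u (\<psi> k) - c k))\<^sup>2)"
  unfolding norm_power2_cinner
  by (subst form_expansion[OF sesquilinear_on_cinner hermitian_on_cinner UNIV_I assms(2),
        where \<nu> = "\<lambda>_. 1" and x = "\<lambda>k. cinner u (\<psi> k)"])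
    (use assms in \<open>simp_all add: orthonormal_basis_def subset_iff\<close>)

lemma cmod_cinner_basis_le:
  assumes "orthonormal_basis \<psi>" "1 \<le> k"
  shows "cmod (cinner u (\<psi> k)) \<le> norm u"
proof -
  have "0 \<le> (norm u)\<^sup>2 - (cmod (cinner u (\<psi> k)))\<^sup>2"
    using orthonormal_basis_bessel[OF assms(1), of "{k}" u "\<lambda>k. cinner u (\<psi> k)"] assms(2)
      zero_le_power2[of "norm (u - cinner u (\<psi> k) *\<^sub>C \<psi> k)"] by simp
  then show ?thesis by (intro power2_le_imp_le[OF _ norm_ge_zero]) simp
qed

lemma bounded_linear_cinner_basis:
  assumes "orthonormal_basis \<psi>" "1 \<le> k"
  shows "bounded_linear (\<lambda>u. cinner u (\<psi> k))"
  by (rule bounded_linear_intro[where K = 1])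
    (use cmod_cinner_basis_le[OF assms] in
      \<open>auto simp: cinner_add_left scaleR_scaleC cinner_scaleC_left scaleR_conv_of_real\<close>)

text \<open>The vectors that agree with all their late partial sums form a subspace containing every
  basis vector, hence the dense span. Best approximation by partial sums carries convergence over
  from the span to its closure.\<close>

lemma orthonormal_basis_expansion:
  assumes "orthonormal_basis \<psi>"
  shows "(\<lambda>M. \<Sum>k\<in>{1..M}. cinner u (\<psi> k) *\<^sub>C \<psi> k) \<longlonglongrightarrow> u"
proof (rule LIMSEQ_I)
  fix r :: real assume r: "0 < r"
  let ?P = "\<lambda>M v. \<Sum>k\<in>{1..M}. cinner v (\<psi> k) *\<^sub>C \<psi> k"
  let ?W = "{v. \<exists>M\<^sub>0. \<forall>M\<ge>M\<^sub>0. ?P M v = v}"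
  have "csubspace ?W"
    unfolding complex_vector.subspace_def
  proof safe
    show "\<exists>M\<^sub>0. \<forall>M\<ge>M\<^sub>0. ?P M 0 = 0"
      by (simp add: cinner_zero_left)
  next
    fix v w M M'
    assume "\<forall>m\<ge>M. ?P m v = v" "\<forall>m\<ge>M'. ?P m w = w"
    then have "\<forall>m\<ge>max M M'. ?P m (v + w) = v + w"
      by (simp add: cinner_add_left scaleC_add_left sum.distrib)
    then show "\<exists>M\<^sub>0. \<forall>M\<ge>M\<^sub>0. ?P M (v + w) = v + w" by blast
  next
    fix v c M
    assume M: "\<forall>m\<ge>M. ?P m v = v"
    have "?P m (c *\<^sub>C v) = c *\<^sub>C ?P m v" for m
      by (simp add: cinner_scaleC_left complex_vector.scale_sum_right scaleC_scaleC)
    then have "\<forall>m\<ge>M. ?P m (c *\<^sub>C v) = c *\<^sub>C v"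
      using M by simp
    then show "\<exists>M\<^sub>0. \<forall>M\<ge>M\<^sub>0. ?P M (c *\<^sub>C v) = c *\<^sub>C v" by blast
  qed
  moreover have "\<psi> j \<in> ?W" if j: "1 \<le> j" for j
  proof -
    have "?P M (\<psi> j) = \<psi> j" if "j \<le> M" for M
    proof -
      have "?P M (\<psi> j) = (\<Sum>k\<in>{1..M}. if k = j then \<psi> k else 0)"
        by (intro sum.cong refl)
          (use assms j in \<open>auto simp: orthonormal_basis_def scaleC_one\<close>)
      then show ?thesis using that j by simp
    qed
    then show ?thesis by blast
  qed
  ultimately have span: "cspan (\<psi> ` {1..}) \<subseteq> ?W"
    by (intro complex_vector.span_minimal) auto
  have "u \<in> closure (cspan (\<psi> ` {1..}))" using assms by (simp add: orthonormal_basis_def)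
  then obtain v where "v \<in> cspan (\<psi> ` {1..})" and v: "norm (u - v) < r"
    using r by (auto simp: closure_approachable dist_norm norm_minus_commute)
  then obtain M\<^sub>0 where M: "\<And>M. M \<ge> M\<^sub>0 \<Longrightarrow> ?P M v = v" using span by auto
  show "\<exists>no. \<forall>n\<ge>no. norm (?P n u - u) < r"
  proof (intro exI allI impI)
    fix n assume "M\<^sub>0 \<le> n"
    have B: "(norm (u - ?P n w))\<^sup>2 = (norm u)\<^sup>2 - (\<Sum>k\<in>{1..n}. (cmod (cinner u (\<psi> k)))\<^sup>2) +
        (\<Sum>k\<in>{1..n}. (cmod (cinner u (\<psi> k) - cinner w (\<psi> k)))\<^sup>2)" for w
      using assms by (intro orthonormal_basis_bessel) auto
    \<comment> \<open>Among all combinations of the first \<open>n\<close> basis vectors, the one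
      with the coefficients of \<open>u\<close> is closest to \<open>u\<close>. In particular it is
      at least as close as \<open>v\<close>, which equals its own partial sum.\<close>
    have "(norm (u - ?P n u))\<^sup>2 \<le> (norm (u - ?P n v))\<^sup>2"
      unfolding B by (simp add: sum_nonneg)
    then have "norm (u - ?P n u) \<le> norm (u - ?P n v)"
      by (rule power2_le_imp_le) simp
    then show "norm (?P n u - u) < r"
      using v M[OF \<open>M\<^sub>0 \<le> n\<close>] by (simp add: norm_minus_commute)
  qed
qed

section \<open>The norm of a positive-definite form\<close>

lemma form_norm_scaleR:
  assumes "sesquilinear_on V a" "u \<in> V"
  shows "form_norm a (r *\<^sub>R u) = \<bar>r\<bar> * form_norm a u"
proof -
  have "complex_of_real r *\<^sub>C u \<in> V"
    using assms by (simp add: sesquilinear_on_def complex_vector.subspace_scale)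
  then have "a (r *\<^sub>R u) (r *\<^sub>R u) = of_real (r\<^sup>2) * a u u"
    using assms by (simp add: scaleR_scaleC sesquilinear_on_def power2_eq_square)
  then show ?thesis by (simp add: form_norm_def real_sqrt_mult)
qed

lemma form_norm_power2:
  assumes "sesquilinear_on V a" "positive_definite_on V a" "u \<in> V"
  shows "(form_norm a u)\<^sup>2 = Re (a u u)" "0 \<le> form_norm a u" "u \<noteq> 0 \<Longrightarrow> 0 < form_norm a u"
proof -
  have "0 \<le> Re (a u u)"
    using assms(2,3) sesquilinear_on_diff(1)[OF assms(1,3,3,3)]
    by (cases "u = 0") (auto simp: positive_definite_on_def intro: less_imp_le)
  then show "(form_norm a u)\<^sup>2 = Re (a u u)" "0 \<le> form_norm a u" by (simp_all add: form_norm_def)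
  show "u \<noteq> 0 \<Longrightarrow> 0 < form_norm a u"
    using assms(2,3) by (simp add: form_norm_def positive_definite_on_def)
qed

lemma form_norm_triangle:
  assumes a: "sesquilinear_on V a" "hermitian_on V a" "positive_definite_on V a"
    and uv: "u \<in> V" "v \<in> V"
  shows "form_norm a (u - v) \<le> form_norm a u + form_norm a v"
proof -
  have V: "csubspace V" using a by (simp add: sesquilinear_on_def)
  have exp: "Re (a (x - y) (x - y)) = Re (a x x) - 2 * Re (a x y) + Re (a y y)"
    if "x \<in> V" "y \<in> V" for x y
  proof -
    have "a y x = cnj (a x y)" using a(2) that unfolding hermitian_on_def by blast
    then show ?thesis
      using sesquilinear_on_diff[OF a(1)] that complex_vector.subspace_diff[OF V] by simp
  qed
  have CS: "\<bar>Re (a u v)\<bar> \<le> form_norm a u * form_norm a v"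
  proof (cases "v = 0")
    case True
    then show ?thesis
      using sesquilinear_on_diff(2)[OF a(1) uv(1,1,1)] form_norm_power2(2)[OF a(1,3)] uv by simp
  next
    case False
    then have vp: "0 < Re (a v v)" using a(3) uv by (simp add: positive_definite_on_def)
    \<comment> \<open>Minimiser over real \<open>t\<close> of the quadratic polynomial a[u - t v].
      Real \<open>t\<close> suffices because the triangle inequality involves only the real part of
      \<open>a u v\<close>.\<close>
    define t where "t = Re (a u v) / Re (a v v)"
    have tv: "complex_of_real t *\<^sub>C v \<in> V" using V uv complex_vector.subspace_scale by blast
    have "a u (of_real t *\<^sub>C v) = t * a u v" "a (of_real t *\<^sub>C v) (of_real t *\<^sub>C v) = t * (t * a v v)"
      using a(1) uv tv by (simp_all add: sesquilinear_on_def)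
    then have "Re (a (u - of_real t *\<^sub>C v) (u - of_real t *\<^sub>C v)) =
        Re (a u u) - 2 * t * Re (a u v) + t * t * Re (a v v)"
      using exp[OF uv(1) tv] by simp
    also have "\<dots> = Re (a u u) - (Re (a u v))\<^sup>2 / Re (a v v)"
      using vp by (simp add: t_def power2_eq_square field_simps)
    finally have "(Re (a u v))\<^sup>2 / Re (a v v) \<le> Re (a u u)"
      using form_norm_power2(1)[OF a(1,3) complex_vector.subspace_diff[OF V uv(1) tv]]
      by (metis diff_ge_0_iff_ge zero_le_power2)
    then have "(Re (a u v))\<^sup>2 \<le> (form_norm a u * form_norm a v)\<^sup>2"
      using vp form_norm_power2(1)[OF a(1,3)] uv by (simp add: power_mult_distrib pos_divide_le_eq)
    then show ?thesis
      using form_norm_power2(2)[OF a(1,3)] uv by (simp add: abs_le_square_iff[symmetric])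
  qed
  have "(form_norm a (u - v))\<^sup>2 \<le> (form_norm a u + form_norm a v)\<^sup>2"
    using CS exp[OF uv] form_norm_power2(1)[OF a(1,3)] uv complex_vector.subspace_diff[OF V uv]
    by (simp add: power2_sum)
  then show ?thesis
    using form_norm_power2(2)[OF a(1,3) uv(1)] form_norm_power2(2)[OF a(1,3) uv(2)]
    by (rule_tac power2_le_imp_le) auto
qed

lemma form_norm_normalized_diff_le:
  assumes a: "sesquilinear_on V a" "hermitian_on V a" "positive_definite_on V a"
    and uv: "u \<in> V" "v \<in> V" and nz: "u \<noteq> 0" "v \<noteq> 0"
  shows "form_norm a ((1 / form_norm a u) *\<^sub>R u - (1 / form_norm a v) *\<^sub>R v) \<le>
    2 * form_norm a (u - v) / form_norm a v"
    and "\<bar>form_norm a u - form_norm a v\<bar> \<le> form_norm a (u - v)"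
proof -
  have V: "csubspace V" using a by (simp add: sesquilinear_on_def)
  have scaleR: "r *\<^sub>R w \<in> V" if "w \<in> V" for w r
    using complex_vector.subspace_scale[OF V that] by (simp add: scaleR_scaleC)
  have d: "u - v \<in> V" using complex_vector.subspace_diff[OF V] uv by blast
  have pos: "0 < form_norm a u" "0 < form_norm a v"
    using form_norm_power2(3)[OF a(1,3)] uv nz by auto
  have commute: "form_norm a (v - u) = form_norm a (u - v)"
    using form_norm_scaleR[OF a(1) d, of "-1"] by simp
  have "form_norm a u \<le> form_norm a (u - v) + form_norm a v"
    using form_norm_triangle[OF a d scaleR[of v "-1"]] uv form_norm_scaleR[OF a(1) uv(2), of "-1"]
    by simp
  moreover have "form_norm a v \<le> form_norm a u + form_norm a (u - v)"
    using form_norm_triangle[OF a uv(1) d] by simp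
  ultimately show abs: "\<bar>form_norm a u - form_norm a v\<bar> \<le> form_norm a (u - v)" by simp
  \<comment> \<open>The difference of the normalised vectors is split into \<open>u - v\<close>
    divided by the norm of \<open>v\<close>, and a multiple of \<open>u\<close> that corrects the
    normalisation. Each piece is at most the norm of \<open>u - v\<close> divided by that of
    \<open>v\<close>, whence the factor 2.\<close>
  let ?r = "1 / form_norm a v - 1 / form_norm a u"
  have "(1 / form_norm a u) *\<^sub>R u - (1 / form_norm a v) *\<^sub>R v =
      (1 / form_norm a v) *\<^sub>R (u - v) - ?r *\<^sub>R u"
    by (simp add: algebra_simps)
  then have "form_norm a ((1 / form_norm a u) *\<^sub>R u - (1 / form_norm a v) *\<^sub>R v) \<le>
      form_norm a ((1 / form_norm a v) *\<^sub>R (u - v)) + form_norm a (?r *\<^sub>R u)"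
    using form_norm_triangle[OF a scaleR[OF d] scaleR[OF uv(1)]] by simp
  also have "\<dots> = form_norm a (u - v) / form_norm a v + \<bar>?r\<bar> * form_norm a u"
    using form_norm_scaleR[OF a(1)] d uv pos by simp
  also have "\<bar>?r\<bar> * form_norm a u = \<bar>?r * form_norm a u\<bar>"
    using pos by (simp add: abs_mult)
  also have "?r * form_norm a u = (form_norm a u - form_norm a v) / form_norm a v"
    using pos by (simp add: field_simps)
  also have "\<bar>\<dots>\<bar> = \<bar>form_norm a u - form_norm a v\<bar> / form_norm a v"
    using pos by simp
  also have "\<dots> \<le> form_norm a (u - v) / form_norm a v"
    using abs pos by (simp add: divide_right_mono)
  finally show "form_norm a ((1 / form_norm a u) *\<^sub>R u - (1 / form_norm a v) *\<^sub>R v) \<le>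
    2 * form_norm a (u - v) / form_norm a v" by simp
qed

section \<open>Sums over a power kernel\<close>

text \<open>The absolute value in the constant allows exponents of either sign, as is required for
  both \<open>1 - \<gamma>\<close> and \<open>- 2 * \<alpha>\<close>.\<close>

lemma powr_comparable:
  fixes x y p :: real
  assumes "0 < x" "x \<le> y" "y \<le> 2 * x"
  shows "x powr p \<le> 2 powr \<bar>p\<bar> * y powr p" "y powr p \<le> 2 powr \<bar>p\<bar> * x powr p"
proof -
  have q: "(y / x) powr r \<le> 2 powr \<bar>p\<bar>" if "r \<le> \<bar>p\<bar>" for r
  proof -
    have "(y / x) powr r \<le> (y / x) powr \<bar>p\<bar>" using assms that by (intro powr_mono) auto
    also have "\<dots> \<le> 2 powr \<bar>p\<bar>" using assms by (intro powr_mono2) (auto simp: pos_divide_le_eq)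
    finally show ?thesis .
  qed
  have y: "y powr r = (y / x) powr r * x powr r" for r
    using assms by (simp flip: powr_mult)
  have "x powr p = (y / x) powr (- p) * y powr p"
    using assms by (simp add: powr_divide powr_minus field_simps)
  also have "\<dots> \<le> 2 powr \<bar>p\<bar> * y powr p" by (intro mult_right_mono q) auto
  finally show "x powr p \<le> 2 powr \<bar>p\<bar> * y powr p" .
  show "y powr p \<le> 2 powr \<bar>p\<bar> * x powr p"
    by (subst y) (intro mult_right_mono q, auto)
qed

lemma sum_powr_le:
  fixes p :: real
  assumes "1 < p"
  obtains Z where "0 < Z" "\<And>F. finite F \<Longrightarrow> F \<subseteq> {1..} \<Longrightarrow> (\<Sum>k\<in>F. real k powr (- p)) \<le> Z"
    "\<And>F n. finite F \<Longrightarrow> (\<Sum>k\<in>F. (1 + \<bar>real n - real k\<bar>) powr (- p)) \<le> Z"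
proof -
  define Z where "Z = (\<Sum>k. real k powr (- p))"
  have S: "summable (\<lambda>k. real k powr (- p))" using assms by (simp add: summable_real_powr_iff)
  have Z: "(\<Sum>k\<in>F. real k powr (- p)) \<le> Z" if "finite F" for F
    unfolding Z_def using that by (intro sum_le_suminf S) auto
  have "0 < Z" using Z[of "{1}"] by simp
  have N: "(\<Sum>k\<in>F. (1 + \<bar>real n - real k\<bar>) powr (- p)) \<le> 2 * Z" if F: "finite F" for F n
  proof -
    \<comment> \<open>The sum is cut at \<open>n\<close>. On either half
      \<open>1 + \<bar>n - k\<bar>\<close> takes each positive integer at most once, so each half is
      at most the full series; this doubles the bound.\<close>
    have inj: "inj_on (\<lambda>k. Suc n - k) (F \<inter> {..n})" "inj_on (\<lambda>k. Suc k - n) (F - {..n})"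
      by (auto simp: inj_on_def)
    have "(\<Sum>k\<in>F. (1 + \<bar>real n - real k\<bar>) powr (- p)) =
        (\<Sum>k\<in>F \<inter> {..n}. (1 + \<bar>real n - real k\<bar>) powr (- p)) +
        (\<Sum>k\<in>F - {..n}. (1 + \<bar>real n - real k\<bar>) powr (- p))"
      using F by (rule sum.Int_Diff)
    also have "(\<Sum>k\<in>F \<inter> {..n}. (1 + \<bar>real n - real k\<bar>) powr (- p)) =
        (\<Sum>j\<in>(\<lambda>k. Suc n - k) ` (F \<inter> {..n}). real j powr (- p))"
      by (subst sum.reindex[OF inj(1)], intro sum.cong refl)
        (auto simp: of_nat_diff add_diff_eq)
    also have "(\<Sum>k\<in>F - {..n}. (1 + \<bar>real n - real k\<bar>) powr (- p)) =
        (\<Sum>j\<in>(\<lambda>k. Suc k - n) ` (F - {..n}). real j powr (- p))"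
      by (subst sum.reindex[OF inj(2)], intro sum.cong refl)
        (auto simp: of_nat_diff algebra_simps)
    finally show ?thesis
      using Z[of "(\<lambda>k. Suc n - k) ` (F \<inter> {..n})"] Z[of "(\<lambda>k. Suc k - n) ` (F - {..n})"] F by simp
  qed
  show thesis
  proof (rule that[of "2 * Z"])
    show "(\<Sum>k\<in>F. real k powr (- p)) \<le> 2 * Z" if "finite F" for F
      using Z[OF that] \<open>0 < Z\<close> by simp
  qed (use \<open>0 < Z\<close> N in auto)
qed

text \<open>
  Up to constants, \<open>kern \<gamma> n k\<close> is the reciprocal of the distance of \<open>n\<^sup>\<gamma>\<close> and
  \<open>k\<^sup>\<gamma>\<close>, regularised on the diagonal.
\<close>

definition kern :: "real \<Rightarrow> nat \<Rightarrow> nat \<Rightarrow> real"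
  where "kern \<gamma> n k =
    max (real n) (real k) powr (1 - \<gamma>) / (1 + \<bar>real n - real k\<bar>)"

lemma kern_nonneg: "0 \<le> kern \<gamma> n k"
  by (simp add: kern_def)

lemma kern_commute: "kern \<gamma> n k = kern \<gamma> k n"
  by (simp add: kern_def max.commute abs_minus_commute)

text \<open>Shares the decay in the maximum between the two indices: one half will give decay in
  \<open>n\<close>, the other half convergence of the sum over \<open>k\<close>.\<close>

lemma powr_split_le:
  fixes x y :: real
  assumes "1 \<le> x" "1 \<le> y" "0 \<le> \<epsilon>"
  shows "max x y powr (- 2 * \<epsilon>) \<le> x powr (- \<epsilon>) * y powr (- \<epsilon>)"
proof -
  have "max x y powr (- 2 * \<epsilon>) = max x y powr (- \<epsilon>) * max x y powr (- \<epsilon>)"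
    by (simp flip: powr_add)
  also have "\<dots> \<le> x powr (- \<epsilon>) * y powr (- \<epsilon>)"
    using assms by (intro mult_mono powr_mono2') auto
  finally show ?thesis .
qed

text \<open>If \<open>n\<close> and \<open>k\<close> differ by a factor of at most 2, the power of
  \<open>k\<close> may be exchanged for the same power of the maximum, whatever the sign of
  \<alpha>.\<close>

lemma kern_near:
  assumes "1 \<le> n" "1 \<le> k" "max (real n) (real k) \<le> 2 * min (real n) (real k)"
  shows "real k powr (- 2 * \<alpha>) * kern \<gamma> n k \<le>
    2 powr \<bar>2 * \<alpha>\<bar> * max (real n) (real k) powr (1 - \<gamma> - 2 * \<alpha>) / (1 + \<bar>real n - real k\<bar>)"
proof -
  have "real k powr (- 2 * \<alpha>) \<le> 2 powr \<bar>- 2 * \<alpha>\<bar> * max (real n) (real k) powr (- 2 * \<alpha>)"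
    using assms by (intro powr_comparable) auto
  then have "real k powr (- 2 * \<alpha>) * kern \<gamma> n k \<le>
      (2 powr \<bar>- 2 * \<alpha>\<bar> * max (real n) (real k) powr (- 2 * \<alpha>)) * kern \<gamma> n k"
    by (intro mult_right_mono kern_nonneg)
  also have "\<dots> = 2 powr \<bar>2 * \<alpha>\<bar> * (max (real n) (real k) powr (- 2 * \<alpha>) *
      max (real n) (real k) powr (1 - \<gamma>)) / (1 + \<bar>real n - real k\<bar>)"
    by (simp add: kern_def)
  finally show ?thesis by (simp flip: powr_add add: algebra_simps)
qed

text \<open>Here the difference of the indices is at least half the maximum, so the kernel is of
  order max powr (- \<gamma>). If 2\<alpha> is at least 1, the power of \<open>k\<close> already
  dominates 1/k in decay. Otherwise the surplus power \<open>k powr (1 - 2 * \<alpha>)\<close> is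
  increasing and is moved to the maximum. The two cases consume the two bounds on
  \<open>\<epsilon>\<close>.\<close>

lemma kern_far:
  assumes nk: "1 \<le> n" "1 \<le> k" and far: "2 * min (real n) (real k) \<le> max (real n) (real k)"
    and \<epsilon>: "2 * \<epsilon> \<le> \<gamma>" "2 * \<epsilon> \<le> 2 * \<alpha> + \<gamma> - 1"
  shows "real k powr (- 2 * \<alpha>) * kern \<gamma> n k \<le>
    2 * real k powr (- 1) * max (real n) (real k) powr (- 2 * \<epsilon>)"
proof -
  let ?y = "max (real n) (real k)"
  have "kern \<gamma> n k \<le> ?y powr (1 - \<gamma>) / (?y / 2)"
    unfolding kern_def using nk far by (intro divide_left_mono) (auto simp: max_def min_def)
  also have "\<dots> = 2 * ?y powr (- \<gamma>)"
    using nk by (simp add: powr_diff powr_minus field_simps)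
  finally have "real k powr (- 2 * \<alpha>) * kern \<gamma> n k \<le>
      2 * (real k powr (- 2 * \<alpha>) * ?y powr (- \<gamma>))"
    by (metis mult.left_commute mult_left_mono powr_ge_zero)
  also have "real k powr (- 2 * \<alpha>) * ?y powr (- \<gamma>) \<le> real k powr (- 1) * ?y powr (- 2 * \<epsilon>)"
  proof (cases "1 \<le> 2 * \<alpha>")
    case True
    then show ?thesis using nk \<epsilon> by (intro mult_mono powr_mono) auto
  next
    case False
    have "real k powr (- 2 * \<alpha>) * ?y powr (- \<gamma>) =
        real k powr (- 1) * (real k powr (1 - 2 * \<alpha>) * ?y powr (- \<gamma>))"
      using nk by (simp add: powr_diff powr_minus field_simps)
    also have "\<dots> \<le> real k powr (- 1) * (?y powr (1 - 2 * \<alpha>) * ?y powr (- \<gamma>))"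
      using False by (intro mult_left_mono mult_right_mono powr_mono2) auto
    also have "\<dots> = real k powr (- 1) * ?y powr (1 - 2 * \<alpha> - \<gamma>)"
      by (simp flip: powr_add)
    also have "\<dots> \<le> real k powr (- 1) * ?y powr (- 2 * \<epsilon>)"
      using nk \<epsilon> by (intro mult_mono powr_mono) auto
    finally show ?thesis .
  qed
  finally show ?thesis by simp
qed

text \<open>Near the diagonal the decay in \<open>k\<close> is replaced by decay in the distance
  from the diagonal, far from it the factor 1/k remains. Splitting the extra decay makes both terms
  summable over \<open>k\<close>, with a power of \<open>n\<close> to spare.\<close>

lemma kern_le:
  assumes \<gamma>: "0 < \<gamma>" and \<alpha>\<gamma>: "1 < 2 * \<alpha> + \<gamma>"
  obtains \<epsilon> C where "0 < \<epsilon>" "0 < C"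
    "\<And>n k. 1 \<le> n \<Longrightarrow> 1 \<le> k \<Longrightarrow> real k powr (- 2 * \<alpha>) * kern \<gamma> n k \<le>
      C * real n powr (- \<epsilon>) *
        ((1 + \<bar>real n - real k\<bar>) powr (- (1 + \<epsilon>)) + real k powr (- (1 + \<epsilon>)))"
proof -
  \<comment> \<open>The largest value satisfying the two exponent conditions of
    \<open>kern_far\<close>.\<close>
  define \<epsilon> where "\<epsilon> = min \<gamma> (2 * \<alpha> + \<gamma> - 1) / 2"
  have \<epsilon>: "0 < \<epsilon>" "2 * \<epsilon> \<le> \<gamma>" "2 * \<epsilon> \<le> 2 * \<alpha> + \<gamma> - 1" using \<gamma> \<alpha>\<gamma> by (auto simp: \<epsilon>_def)
  define C where "C = 2 powr \<bar>2 * \<alpha>\<bar> + 2"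
  have C: "2 powr \<bar>2 * \<alpha>\<bar> \<le> C" "2 \<le> C" by (simp_all add: C_def)
  show thesis
  proof (rule that)
    show "0 < \<epsilon>" "0 < C" using \<epsilon> C by simp_all
    fix n k :: nat
    assume nk: "1 \<le> n" "1 \<le> k"
    let ?y = "max (real n) (real k)" and ?d = "1 + \<bar>real n - real k\<bar>"
    \<comment> \<open>Since both indices are at least 1, the shifted distance does not exceed the
      maximum, so decay in the maximum may be spent on \<open>?d\<close>.\<close>
    have d: "1 \<le> ?d" "?d \<le> ?y" using nk by auto
    show "real k powr (- 2 * \<alpha>) * kern \<gamma> n k \<le>
      C * real n powr (- \<epsilon>) * (?d powr (- (1 + \<epsilon>)) + real k powr (- (1 + \<epsilon>)))"
    proof (cases "?y \<le> 2 * min (real n) (real k)")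
      case True
      have "?y powr (1 - \<gamma> - 2 * \<alpha>) \<le> ?y powr (- 2 * \<epsilon>)"
        using \<epsilon> nk by (intro powr_mono) auto
      also have "\<dots> \<le> max (real n) ?d powr (- 2 * \<epsilon>)"
        using \<epsilon> nk d by (intro powr_mono2') auto
      also have "\<dots> \<le> real n powr (- \<epsilon>) * ?d powr (- \<epsilon>)"
        using nk d \<epsilon> by (intro powr_split_le) auto
      finally have "2 powr \<bar>2 * \<alpha>\<bar> * ?y powr (1 - \<gamma> - 2 * \<alpha>) / ?d \<le>
          C * (real n powr (- \<epsilon>) * ?d powr (- \<epsilon>)) / ?d"
        using C d by (intro divide_right_mono mult_mono) auto
      also have "\<dots> = C * real n powr (- \<epsilon>) * ?d powr (- (1 + \<epsilon>))"
        using d by (simp add: powr_diff powr_minus powr_add field_simps)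
      finally show ?thesis
        using kern_near[OF nk True, of \<alpha> \<gamma>] C(2)
        by (smt (verit) mult_left_mono mult_nonneg_nonneg powr_ge_zero)
    next
      case False
      have "real k powr (- 2 * \<alpha>) * kern \<gamma> n k \<le> 2 * real k powr (- 1) * ?y powr (- 2 * \<epsilon>)"
        using nk \<epsilon> False by (intro kern_far) auto
      also have "\<dots> \<le> C * real k powr (- 1) * (real n powr (- \<epsilon>) * real k powr (- \<epsilon>))"
        using C(2) nk \<epsilon> by (intro mult_mono powr_split_le) auto
      also have "\<dots> = C * real n powr (- \<epsilon>) * real k powr (- (1 + \<epsilon>))"
        by (simp add: powr_add powr_diff powr_minus field_simps)
      finally show ?thesis
        using C(2) by (smt (verit) mult_left_mono mult_nonneg_nonneg powr_ge_zero)
    qed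
  qed
qed

text \<open>This is where 3/2 enters: near the diagonal the squared kernel carries the power -
  2(2\<alpha> + \<gamma> - 1) of the maximum, and this exponent must lie below -1 for summability in
  \<open>n\<close>.\<close>

lemma kern_square_le:
  assumes \<gamma>: "0 < \<gamma>" and \<alpha>\<gamma>: "3 / 2 < 2 * \<alpha> + \<gamma>"
  obtains \<delta> C where "0 < \<delta>" "0 < C"
    "\<And>n k. 1 \<le> n \<Longrightarrow> 1 \<le> k \<Longrightarrow>
      real n powr (- 2 * \<alpha>) * real k powr (- 2 * \<alpha>) * (kern \<gamma> n k)\<^sup>2 \<le>
      C * real n powr (- (1 + \<delta>)) *
        ((1 + \<bar>real n - real k\<bar>) powr (- (1 + \<delta>)) + real k powr (- (1 + \<delta>)))"
proof -
  \<comment> \<open>The bound by 1 lets the factor \<open>?d powr (- 2)\<close> absorb the exponent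
    \<open>1 + \<delta>\<close>; the bound by \<gamma> serves \<open>kern_far\<close>; the last
    bound gives the near-diagonal decay.\<close>
  define \<delta> where "\<delta> = min 1 (min \<gamma> (2 * (2 * \<alpha> + \<gamma> - 1) - 1))"
  have \<delta>: "0 < \<delta>" "\<delta> \<le> 1" "\<delta> \<le> \<gamma>" "1 + \<delta> \<le> 2 * (2 * \<alpha> + \<gamma> - 1)"
    using \<gamma> \<alpha>\<gamma> by (auto simp: \<delta>_def)
  define C where "C = (2 powr \<bar>2 * \<alpha>\<bar>)\<^sup>2 + 4"
  have C: "(2 powr \<bar>2 * \<alpha>\<bar>)\<^sup>2 \<le> C" "4 \<le> C" by (simp_all add: C_def)
  show thesis
  proof (rule that)
    show "0 < \<delta>" "0 < C" using \<delta> C by simp_all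
    fix n k :: nat
    assume nk: "1 \<le> n" "1 \<le> k"
    let ?y = "max (real n) (real k)" and ?d = "1 + \<bar>real n - real k\<bar>"
    \<comment> \<open>By symmetry of the kernel the square factors into two single-kernel
      expressions with the roles of \<open>n\<close> and \<open>k\<close> exchanged, so the linear
      estimates apply to each.\<close>
    have eq: "real n powr (- 2 * \<alpha>) * real k powr (- 2 * \<alpha>) * (kern \<gamma> n k)\<^sup>2 =
        (real n powr (- 2 * \<alpha>) * kern \<gamma> k n) * (real k powr (- 2 * \<alpha>) * kern \<gamma> n k)"
      by (simp add: kern_commute[of \<gamma> k n] power2_eq_square)
    have sym: "max (real k) (real n) = ?y" "min (real k) (real n) = min (real n) (real k)"
      "\<bar>real k - real n\<bar> = \<bar>real n - real k\<bar>" by auto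
    show "real n powr (- 2 * \<alpha>) * real k powr (- 2 * \<alpha>) * (kern \<gamma> n k)\<^sup>2 \<le>
      C * real n powr (- (1 + \<delta>)) * (?d powr (- (1 + \<delta>)) + real k powr (- (1 + \<delta>)))"
    proof (cases "?y \<le> 2 * min (real n) (real k)")
      case True
      let ?B = "2 powr \<bar>2 * \<alpha>\<bar> * ?y powr (1 - \<gamma> - 2 * \<alpha>) / ?d"
      have "real n powr (- 2 * \<alpha>) * kern \<gamma> k n \<le> ?B" "real k powr (- 2 * \<alpha>) * kern \<gamma> n k \<le> ?B"
        using kern_near[OF nk True, of \<alpha> \<gamma>] kern_near[OF nk(2,1), of \<alpha> \<gamma>] True
        unfolding sym by auto
      then have "(real n powr (- 2 * \<alpha>) * kern \<gamma> k n) * (real k powr (- 2 * \<alpha>) * kern \<gamma> n k) \<le> ?B * ?B"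
        by (intro mult_mono) (auto simp: kern_nonneg)
      also have "\<dots> = (2 powr \<bar>2 * \<alpha>\<bar>)\<^sup>2 *
          (?y powr (1 - \<gamma> - 2 * \<alpha>) * ?y powr (1 - \<gamma> - 2 * \<alpha>)) * ?d powr (- 2)"
        by (simp add: power2_eq_square powr_minus divide_inverse)
      also have "?y powr (1 - \<gamma> - 2 * \<alpha>) * ?y powr (1 - \<gamma> - 2 * \<alpha>) =
          ?y powr (- (2 * (2 * \<alpha> + \<gamma> - 1)))"
        by (simp add: algebra_simps flip: powr_add)
      also have "(2 powr \<bar>2 * \<alpha>\<bar>)\<^sup>2 * ?y powr (- (2 * (2 * \<alpha> + \<gamma> - 1))) * ?d powr (- 2) \<le>
          C * real n powr (- (1 + \<delta>)) * ?d powr (- (1 + \<delta>))"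
      proof (intro mult_mono C)
        have "?y powr (- (2 * (2 * \<alpha> + \<gamma> - 1))) \<le> ?y powr (- (1 + \<delta>))"
          using nk \<delta> by (intro powr_mono) auto
        also have "\<dots> \<le> real n powr (- (1 + \<delta>))"
          using nk \<delta> by (intro powr_mono2') auto
        finally show "?y powr (- (2 * (2 * \<alpha> + \<gamma> - 1))) \<le> real n powr (- (1 + \<delta>))" .
        show "?d powr (- 2) \<le> ?d powr (- (1 + \<delta>))" using \<delta> by (intro powr_mono) auto
      qed (use C in auto)
      finally show ?thesis
        unfolding eq using C(2) by (smt (verit) mult_left_mono mult_nonneg_nonneg powr_ge_zero)
    next
      case False
      \<comment> \<open>The second bound combines \<open>\<delta> \<le> 1\<close> with
        \<open>1 + \<delta> \<le> 2 * (2 * \<alpha> + \<gamma> - 1)\<close>.\<close>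
      have \<epsilon>: "2 * (\<delta> / 2) \<le> \<gamma>" "2 * (\<delta> / 2) \<le> 2 * \<alpha> + \<gamma> - 1" using \<delta> by auto
      have far: "2 * min (real n) (real k) \<le> ?y" using False by linarith
      have "(real n powr (- 2 * \<alpha>) * kern \<gamma> k n) * (real k powr (- 2 * \<alpha>) * kern \<gamma> n k) \<le>
          (2 * real n powr (- 1) * ?y powr (- 2 * (\<delta> / 2))) *
          (2 * real k powr (- 1) * ?y powr (- 2 * (\<delta> / 2)))"
        by (rule mult_mono)
          (use kern_far[OF nk far \<epsilon>] kern_far[OF nk(2,1) far[folded sym] \<epsilon>] in
            \<open>simp_all only: sym\<close>, simp_all add: kern_nonneg)
      also have "\<dots> = 4 * (real n powr (- 1) * real k powr (- 1)) * ?y powr (- 2 * \<delta>)"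
        by (simp add: algebra_simps flip: powr_add)
      also have "\<dots> \<le> C * (real n powr (- 1) * real k powr (- 1)) *
          (real n powr (- \<delta>) * real k powr (- \<delta>))"
        using C(2) nk \<delta> by (intro mult_mono powr_split_le) auto
      also have "\<dots> = C * real n powr (- (1 + \<delta>)) * real k powr (- (1 + \<delta>))"
        by (simp add: powr_add powr_diff powr_minus field_simps)
      finally show ?thesis
        unfolding eq using C(2) by (smt (verit) mult_left_mono mult_nonneg_nonneg powr_ge_zero)
    qed
  qed
qed

lemma kern_le_const:
  assumes "0 < \<gamma>" "1 < 2 * \<alpha> + \<gamma>"
  obtains C where "0 < C" "\<And>n k. 1 \<le> n \<Longrightarrow> 1 \<le> k \<Longrightarrow> real k powr (- 2 * \<alpha>) * kern \<gamma> n k \<le> C"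
proof -
  obtain \<epsilon> C where \<epsilon>: "0 < \<epsilon>" "0 < C" and *: "\<And>n k. 1 \<le> n \<Longrightarrow> 1 \<le> k \<Longrightarrow>
    real k powr (- 2 * \<alpha>) * kern \<gamma> n k \<le> C * real n powr (- \<epsilon>) *
        ((1 + \<bar>real n - real k\<bar>) powr (- (1 + \<epsilon>)) + real k powr (- (1 + \<epsilon>)))"
    using kern_le[OF assms] by metis
  have le1: "x powr (- p) \<le> 1" if "1 \<le> x" "0 \<le> p" for x p :: real
    using powr_mono2'[of "- p" 1 x] that by simp
  show thesis
  proof (rule that)
    fix n k :: nat assume nk: "1 \<le> n" "1 \<le> k"
    have "C * real n powr (- \<epsilon>) *
        ((1 + \<bar>real n - real k\<bar>) powr (- (1 + \<epsilon>)) + real k powr (- (1 + \<epsilon>))) \<le> C * 1 * (1 + 1)"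
      using nk \<epsilon> by (intro mult_mono add_mono le1) auto
    then show "real k powr (- 2 * \<alpha>) * kern \<gamma> n k \<le> C * 2" using *[OF nk] by simp
  qed (use \<epsilon> in simp)
qed

text \<open>Once the kernel is known to bound the reciprocal distances from the \<open>n\<close>-th
  contour, this says that the perturbation becomes negligible on the contours as \<open>n\<close>
  grows.\<close>

lemma kern_sum_le:
  assumes "0 < \<gamma>" "1 < 2 * \<alpha> + \<gamma>"
  obtains \<epsilon> C where "0 < \<epsilon>" "0 < C"
    "\<And>n F. 1 \<le> n \<Longrightarrow> finite F \<Longrightarrow> F \<subseteq> {1..} \<Longrightarrow>
      (\<Sum>k\<in>F. real k powr (- 2 * \<alpha>) * kern \<gamma> n k) \<le> C * real n powr (- \<epsilon>)"
proof -
  obtain \<epsilon> C where \<epsilon>: "0 < \<epsilon>" "0 < C" and *: "\<And>n k. 1 \<le> n \<Longrightarrow> 1 \<le> k \<Longrightarrow>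
    real k powr (- 2 * \<alpha>) * kern \<gamma> n k \<le> C * real n powr (- \<epsilon>) *
        ((1 + \<bar>real n - real k\<bar>) powr (- (1 + \<epsilon>)) + real k powr (- (1 + \<epsilon>)))"
    using kern_le[OF assms] by metis
  obtain Z where Z: "0 < Z"
    "\<And>F. finite F \<Longrightarrow> F \<subseteq> {1..} \<Longrightarrow> (\<Sum>k\<in>F. real k powr (- (1 + \<epsilon>))) \<le> Z"
    "\<And>F n. finite F \<Longrightarrow> (\<Sum>k\<in>F. (1 + \<bar>real n - real k\<bar>) powr (- (1 + \<epsilon>))) \<le> Z"
    using sum_powr_le[of "1 + \<epsilon>"] \<epsilon> by (metis less_add_same_cancel1)
  show thesis
  proof (rule that)
    fix n :: nat and F :: "nat set"
    assume n: "1 \<le> n" and F: "finite F" "F \<subseteq> {1..}"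
    have "(\<Sum>k\<in>F. real k powr (- 2 * \<alpha>) * kern \<gamma> n k) \<le> (\<Sum>k\<in>F. C * real n powr (- \<epsilon>) *
        ((1 + \<bar>real n - real k\<bar>) powr (- (1 + \<epsilon>)) + real k powr (- (1 + \<epsilon>))))"
      using F n by (intro sum_mono *) auto
    also have "\<dots> = C * real n powr (- \<epsilon>) * ((\<Sum>k\<in>F. (1 + \<bar>real n - real k\<bar>) powr (- (1 + \<epsilon>))) +
        (\<Sum>k\<in>F. real k powr (- (1 + \<epsilon>))))"
      by (simp add: sum.distrib flip: sum_distrib_left)
    also have "\<dots> \<le> C * real n powr (- \<epsilon>) * (Z + Z)"
      using \<epsilon> Z F by (intro mult_left_mono add_mono) auto
    finally show "(\<Sum>k\<in>F. real k powr (- 2 * \<alpha>) * kern \<gamma> n k) \<le> (C * (2 * Z)) * real n powr (- \<epsilon>)"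
      by (simp add: mult_ac)
  qed (use \<epsilon> Z in auto)
qed

text \<open>The exponent exceeds 1, so the bound is summable over \<open>n\<close> as well;
  quadratic closeness rests on this.\<close>

lemma kern_square_sum_le:
  assumes "0 < \<gamma>" "3 / 2 < 2 * \<alpha> + \<gamma>"
  obtains \<delta> C where "0 < \<delta>" "0 < C"
    "\<And>n F. 1 \<le> n \<Longrightarrow> finite F \<Longrightarrow> F \<subseteq> {1..} \<Longrightarrow>
      (\<Sum>k\<in>F. real n powr (- 2 * \<alpha>) * real k powr (- 2 * \<alpha>) * (kern \<gamma> n k)\<^sup>2) \<le>
      C * real n powr (- (1 + \<delta>))"
proof -
  obtain \<delta> C where \<delta>: "0 < \<delta>" "0 < C" and *: "\<And>n k. 1 \<le> n \<Longrightarrow> 1 \<le> k \<Longrightarrow>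
      real n powr (- 2 * \<alpha>) * real k powr (- 2 * \<alpha>) * (kern \<gamma> n k)\<^sup>2 \<le>
      C * real n powr (- (1 + \<delta>)) *
        ((1 + \<bar>real n - real k\<bar>) powr (- (1 + \<delta>)) + real k powr (- (1 + \<delta>)))"
    using kern_square_le[OF assms] by metis
  obtain Z where Z: "0 < Z"
    "\<And>F. finite F \<Longrightarrow> F \<subseteq> {1..} \<Longrightarrow> (\<Sum>k\<in>F. real k powr (- (1 + \<delta>))) \<le> Z"
    "\<And>F n. finite F \<Longrightarrow> (\<Sum>k\<in>F. (1 + \<bar>real n - real k\<bar>) powr (- (1 + \<delta>))) \<le> Z"
    using sum_powr_le[of "1 + \<delta>"] \<delta> by (metis less_add_same_cancel1)
  show thesis
  proof (rule that)
    fix n :: nat and F :: "nat set"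
    assume n: "1 \<le> n" and F: "finite F" "F \<subseteq> {1..}"
    have "(\<Sum>k\<in>F. real n powr (- 2 * \<alpha>) * real k powr (- 2 * \<alpha>) * (kern \<gamma> n k)\<^sup>2) \<le>
        (\<Sum>k\<in>F. C * real n powr (- (1 + \<delta>)) *
        ((1 + \<bar>real n - real k\<bar>) powr (- (1 + \<delta>)) + real k powr (- (1 + \<delta>))))"
      using F n by (intro sum_mono *) auto
    also have "\<dots> = C * real n powr (- (1 + \<delta>)) *
        ((\<Sum>k\<in>F. (1 + \<bar>real n - real k\<bar>) powr (- (1 + \<delta>))) + (\<Sum>k\<in>F. real k powr (- (1 + \<delta>))))"
      by (simp add: sum.distrib flip: sum_distrib_left)
    also have "\<dots> \<le> C * real n powr (- (1 + \<delta>)) * (Z + Z)"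
      using \<delta> Z F by (intro mult_left_mono add_mono) auto
    finally show "(\<Sum>k\<in>F. real n powr (- 2 * \<alpha>) * real k powr (- 2 * \<alpha>) * (kern \<gamma> n k)\<^sup>2) \<le>
        (C * (2 * Z)) * real n powr (- (1 + \<delta>))"
      by (simp add: mult_ac)
  qed (use \<delta> Z in auto)
qed

section \<open>Spectral gaps and the contours\<close>

text \<open>The gaps between \<open>j\<close> and \<open>i\<close> are added up. For \<gamma> at
  most 1 the comparison gaps decrease, so each is at least the last one. For larger \<gamma> they
  are compared with the increments of k powr \<gamma>, which telescope. The constant depends on
  \<gamma> alone, so the sequence may be rescaled afterwards.\<close>

lemma powr_gap_le:
  fixes \<gamma> :: real
  assumes "0 < \<gamma>"
  obtains c where "0 < c" "\<And>\<mu> i j N. (\<And>k. N \<le> k \<Longrightarrow> real k powr (\<gamma> - 1) \<le> \<mu> (Suc k) - \<mu> k) \<Longrightarrow>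
    0 < N \<Longrightarrow> N \<le> j \<Longrightarrow> j \<le> i \<Longrightarrow> c * (real i - real j) * real i powr (\<gamma> - 1) \<le> \<mu> i - \<mu> j"
proof (cases "\<gamma> \<le> 1")
  case True
  have *: "1 * (real i - real j) * real i powr (\<gamma> - 1) \<le> \<mu> i - \<mu> j"
    if gap: "\<And>k. N \<le> k \<Longrightarrow> real k powr (\<gamma> - 1) \<le> \<mu> (Suc k) - \<mu> k" and "0 < N" "N \<le> j" "j \<le> i"
    for \<mu> i j N
    using \<open>j \<le> i\<close>
  proof (induction i rule: dec_induct)
    case (step i)
    have *: "real (Suc i) powr (\<gamma> - 1) \<le> real i powr (\<gamma> - 1)"
      using True step that by (intro powr_mono2') auto
    have "(real (Suc i) - real j) * real (Suc i) powr (\<gamma> - 1) =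
        (real i - real j) * real (Suc i) powr (\<gamma> - 1) + real (Suc i) powr (\<gamma> - 1)"
      by (simp add: algebra_simps)
    also have "\<dots> \<le> (real i - real j) * real i powr (\<gamma> - 1) + real i powr (\<gamma> - 1)"
      using step * by (intro add_mono mult_left_mono) auto
    also have "\<dots> \<le> (\<mu> i - \<mu> j) + (\<mu> (Suc i) - \<mu> i)"
      using gap[of i] step that by (intro add_mono) auto
    finally show ?case by simp
  qed simp
  show thesis by (rule that[OF zero_less_one *])
next
  case False
  \<comment> \<open>By the mean value theorem an increment of k powr \<gamma> is \<gamma> * z powr
    (\<gamma> - 1) with \<open>z\<close> below \<open>k + 1\<close>, hence below
    \<open>2 * k\<close>; \<open>c\<close> is the reciprocal of the resulting factor.\<close>
  define c where "c = 1 / (\<gamma> * 2 powr (\<gamma> - 1))"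
  have c: "0 < c" using assms by (simp add: c_def)
  have step_le: "c * (real (Suc k) powr \<gamma> - real k powr \<gamma>) \<le> real k powr (\<gamma> - 1)" if "1 \<le> k" for k
  proof -
    have "\<exists>z. real k < z \<and> z < real (Suc k) \<and> real (Suc k) powr \<gamma> - real k powr \<gamma> =
        (real (Suc k) - real k) * (\<gamma> * z powr (\<gamma> - 1))"
      by (rule MVT2) (use that in \<open>auto intro!: derivative_eq_intros simp: field_simps powr_diff\<close>)
    then obtain z where z: "real k < z" "z < real (Suc k)" and
      eq: "real (Suc k) powr \<gamma> - real k powr \<gamma> = \<gamma> * z powr (\<gamma> - 1)" by auto
    have "z powr (\<gamma> - 1) \<le> (2 * real k) powr (\<gamma> - 1)"
      using z that False by (intro powr_mono2) auto
    then have "z powr (\<gamma> - 1) \<le> 2 powr (\<gamma> - 1) * real k powr (\<gamma> - 1)"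
      by (simp add: powr_mult)
    then show ?thesis
      unfolding eq c_def using assms by (simp add: field_simps)
  qed
  have *: "c * (real i - real j) * real i powr (\<gamma> - 1) \<le> \<mu> i - \<mu> j"
    if gap: "\<And>k. N \<le> k \<Longrightarrow> real k powr (\<gamma> - 1) \<le> \<mu> (Suc k) - \<mu> k" and "0 < N" "N \<le> j" "j \<le> i"
    for \<mu> i j N
  proof -
    have tel: "c * (real i powr \<gamma> - real j powr \<gamma>) \<le> \<mu> i - \<mu> j"
      using \<open>j \<le> i\<close>
    proof (induction i rule: dec_induct)
      case (step i)
      have "c * (real (Suc i) powr \<gamma> - real i powr \<gamma>) \<le> \<mu> (Suc i) - \<mu> i"
        using order_trans[OF step_le gap[OF order_trans[OF that(3) step(1)]]] that step(1) by simp
      then show ?case using step.IH by (simp add: right_diff_distrib)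
    qed simp
    have split: "x * x powr (\<gamma> - 1) = x powr \<gamma>" if "0 < x" for x
      using that by (simp add: powr_diff)
    \<comment> \<open>Raising the power at \<open>j\<close> to the one at \<open>i\<close> turns the
      difference of \<gamma>-th powers into the product of the index difference and
      \<open>i powr (\<gamma> - 1)\<close>.\<close>
    have "real j * real j powr (\<gamma> - 1) \<le> real j * real i powr (\<gamma> - 1)"
      using that False by (intro mult_left_mono powr_mono2) auto
    then have "(real i - real j) * real i powr (\<gamma> - 1) \<le> real i powr \<gamma> - real j powr \<gamma>"
      using split[of "real i"] split[of "real j"] that by (simp add: left_diff_distrib)
    then have "c * ((real i - real j) * real i powr (\<gamma> - 1)) \<le> c * (real i powr \<gamma> - real j powr \<gamma>)"
      using c by simp
    then show ?thesis using tel by (simp add: mult.assoc)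
  qed
  show thesis by (rule that[OF c *])
qed

text \<open>Isolates the scalar data: the eigenvalues of \<open>A\<close>, their gaps and the
  contours, apart from any Hilbert space.\<close>

locale gap_sequence =
  fixes \<mu> :: "nat \<Rightarrow> real" and \<gamma> \<kappa> :: real and N\<^sub>0 :: nat
  assumes mu_pos: "0 < \<mu> 1" and mu_mono: "mono_on {1..} \<mu>"
    and gamma_pos: "0 < \<gamma>" and kappa_pos: "0 < \<kappa>" and N0_pos: "0 < N\<^sub>0"
    and gap: "\<And>k. N\<^sub>0 \<le> k \<Longrightarrow> \<kappa> * real k powr (\<gamma> - 1) \<le> \<mu> (Suc k) - \<mu> k"
begin

lemma mu_le: "1 \<le> j \<Longrightarrow> j \<le> k \<Longrightarrow> \<mu> j \<le> \<mu> k"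
  using mu_mono by (auto simp: mono_on_def)

lemma mu_gt_0: "1 \<le> k \<Longrightarrow> 0 < \<mu> k"
  using mu_le[of 1 k] mu_pos by simp

text \<open>The gap condition starts only at \<open>N\<^sub>0\<close>. For smaller \<open>j\<close>
  the eigenvalue at \<open>j\<close> is replaced by the one at \<open>N\<^sub>0\<close>; since
  \<open>i\<close> is at least \<open>2 * N\<^sub>0\<close>, this at most halves the index
  difference, and the constant is halved accordingly.\<close>

lemma mu_diff_ge:
  obtains c where "0 < c"
    "\<And>i j. 2 * N\<^sub>0 \<le> i \<Longrightarrow> 1 \<le> j \<Longrightarrow> j \<le> i \<Longrightarrow>
      c * (real i - real j) * real i powr (\<gamma> - 1) \<le> \<mu> i - \<mu> j"
proof -
  obtain c where c: "0 < c" and *: "\<And>\<nu> i j N. (\<And>k. N \<le> k \<Longrightarrow> real k powr (\<gamma> - 1) \<le> \<nu> (Suc k) - \<nu> k) \<Longrightarrow>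
    0 < N \<Longrightarrow> N \<le> j \<Longrightarrow> j \<le> i \<Longrightarrow> c * (real i - real j) * real i powr (\<gamma> - 1) \<le> \<nu> i - \<nu> j"
    using powr_gap_le[OF gamma_pos] by metis
  have base: "\<kappa> * c * (real i - real j) * real i powr (\<gamma> - 1) \<le> \<mu> i - \<mu> j"
    if "N\<^sub>0 \<le> j" "j \<le> i" for i j
  proof -
    have "c * (real i - real j) * real i powr (\<gamma> - 1) \<le> \<mu> i / \<kappa> - \<mu> j / \<kappa>"
      using gap kappa_pos N0_pos that
      by (intro *[of N\<^sub>0 "\<lambda>k. \<mu> k / \<kappa>"]) (auto simp: field_simps)
    then have "\<kappa> * (c * (real i - real j) * real i powr (\<gamma> - 1)) \<le> \<kappa> * (\<mu> i / \<kappa> - \<mu> j / \<kappa>)"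
      using kappa_pos by (intro mult_left_mono) auto
    moreover have "\<kappa> * (\<mu> i / \<kappa> - \<mu> j / \<kappa>) = \<mu> i - \<mu> j"
      using kappa_pos by (simp add: right_diff_distrib)
    ultimately show ?thesis by (simp only: mult.assoc)
  qed
  show thesis
  proof (rule that)
    show "0 < \<kappa> * c / 2" using kappa_pos c by simp
    fix i j assume ij: "2 * N\<^sub>0 \<le> i" "1 \<le> j" "j \<le> i"
    have q: "\<kappa> * c / 2 * (real i - real j) * real i powr (\<gamma> - 1) \<le>
        \<kappa> * c * x * real i powr (\<gamma> - 1)" if "real i - real j \<le> 2 * x" for x
      using mult_left_mono[OF that, of "\<kappa> * c * real i powr (\<gamma> - 1)"] kappa_pos c
      by (simp add: mult_ac)
    show "\<kappa> * c / 2 * (real i - real j) * real i powr (\<gamma> - 1) \<le> \<mu> i - \<mu> j"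
    proof (cases "N\<^sub>0 \<le> j")
      case True
      then show ?thesis using q[of "real i - real j"] base[of j i] ij by simp
    next
      case False
      then have "\<mu> j \<le> \<mu> N\<^sub>0" using ij by (intro mu_le) auto
      then show ?thesis using q[of "real i - real N\<^sub>0"] base[of N\<^sub>0 i] ij by simp
    qed
  qed
qed

lemma mu_dist_ge:
  obtains c where "0 < c"
    "\<And>n k. 2 * N\<^sub>0 \<le> n \<Longrightarrow> 1 \<le> k \<Longrightarrow> k \<noteq> n \<Longrightarrow> c \<le> kern \<gamma> n k * \<bar>\<mu> n - \<mu> k\<bar>"
    "\<And>n. 2 * N\<^sub>0 \<le> n \<Longrightarrow> c * real n powr \<gamma> \<le> \<mu> n"
proof -
  obtain c where c: "0 < c" and *: "\<And>i j. 2 * N\<^sub>0 \<le> i \<Longrightarrow> 1 \<le> j \<Longrightarrow> j \<le> i \<Longrightarrow>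
      c * (real i - real j) * real i powr (\<gamma> - 1) \<le> \<mu> i - \<mu> j"
    using mu_diff_ge by metis
  have **: "c / 2 \<le> kern \<gamma> i j * \<bar>\<mu> i - \<mu> j\<bar>" if "2 * N\<^sub>0 \<le> i" "1 \<le> j" "j < i" for i j
  proof -
    have i: "0 < real i powr (1 - \<gamma>)" "real i powr (1 - \<gamma>) * real i powr (\<gamma> - 1) = 1"
      using that by (auto simp flip: powr_add)
    \<comment> \<open>Distinct indices differ by at least 1, so the shift by 1 in the denominator of
      the kernel costs a factor of at most 2.\<close>
    have "c / 2 * (1 + (real i - real j)) \<le> c * (real i - real j)"
    proof -
      have "real i - real j \<ge> 1" using that by linarith
      then have "c * (1 + (real i - real j)) \<le> c * (2 * (real i - real j))"
        using c by (intro mult_left_mono) auto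
      then show ?thesis by (simp add: algebra_simps) argo
    qed
    also have "\<dots> = real i powr (1 - \<gamma>) * (c * (real i - real j) * real i powr (\<gamma> - 1))"
      using i(2) by (simp add: mult.left_commute[of "real i powr (1 - \<gamma>)"])
    also have "\<dots> \<le> real i powr (1 - \<gamma>) * \<bar>\<mu> i - \<mu> j\<bar>"
      using *[of i j] that by (intro mult_left_mono) auto
    finally show ?thesis
      using that by (simp add: kern_def max_def field_simps)
  qed
  show thesis
  proof (rule that)
    show "0 < c / 2" using c by simp
    show "c / 2 \<le> kern \<gamma> n k * \<bar>\<mu> n - \<mu> k\<bar>" if "2 * N\<^sub>0 \<le> n" "1 \<le> k" "k \<noteq> n" for n k
    proof (cases "k < n")
      case True
      then show ?thesis using ** that by blast
    next
      case False
      then have "c / 2 \<le> kern \<gamma> k n * \<bar>\<mu> k - \<mu> n\<bar>" using that N0_pos by (intro **) auto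
      then show ?thesis by (simp add: kern_commute abs_minus_commute)
    qed
    show "c / 2 * real n powr \<gamma> \<le> \<mu> n" if "2 * N\<^sub>0 \<le> n" for n
    proof -
      have n: "2 \<le> n" using that N0_pos by simp
      have "c / 2 * real n powr \<gamma> = c * (real n / 2) * real n powr (\<gamma> - 1)"
        using n by (simp add: powr_diff)
      also have "\<dots> \<le> c * (real n - real 1) * real n powr (\<gamma> - 1)"
        using n c by (intro mult_right_mono mult_left_mono) auto
      also have "\<dots> \<le> \<mu> n - \<mu> 1" using n that by (intro *) auto
      finally show ?thesis using mu_pos by simp
    qed
  qed
qed

abbreviation \<Gamma> :: "nat \<Rightarrow> real \<Rightarrow> complex"
  where "\<Gamma> \<equiv> Gamma_path \<mu> \<kappa> \<gamma>"

definition ll :: "nat \<Rightarrow> complex"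
  where "ll n = Complex (\<mu> n - \<kappa> / 2 * (real n - 1) powr (\<gamma> - 1)) (- (\<kappa> / 2 * real n powr (\<gamma> - 1)))"

definition ur :: "nat \<Rightarrow> complex"
  where "ur n = Complex (\<mu> n + \<kappa> / 2 * real n powr (\<gamma> - 1)) (\<kappa> / 2 * real n powr (\<gamma> - 1))"

lemma Gamma_eq: "\<Gamma> n = rectpath (ll n) (ur n)"
  by (simp add: Gamma_path_def ll_def ur_def)

lemma powr_pred_le:
  assumes "2 \<le> n"
  shows "(real n - 1) powr p \<le> 2 powr \<bar>p\<bar> * real n powr p"
    "real n powr p \<le> 2 powr \<bar>p\<bar> * (real n - 1) powr p"
  using powr_comparable[of "real n - 1" "real n" p] assms by auto

lemma mu_in_box:
  assumes "2 \<le> n"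
  shows "complex_of_real (\<mu> n) \<in> box (ll n) (ur n)"
  using assms kappa_pos by (simp add: in_box_complex_iff ll_def ur_def)

lemma path_image_Gamma:
  assumes "2 \<le> n"
  shows "path_image (\<Gamma> n) = cbox (ll n) (ur n) - box (ll n) (ur n)"
  unfolding Gamma_eq using assms kappa_pos
  by (intro path_image_rectpath_cbox_minus_box)
    (auto simp: ll_def ur_def intro: order_trans[of _ 0] order_trans[of _ "\<mu> n"])

text \<open>The distance of an eigenvalue of \<open>A\<close> from the whole contour; it replaces
  \<open>cmod (z - \<mu> k)\<close> to make the estimates uniform in \<open>z\<close>.\<close>

definition cdist :: "nat \<Rightarrow> nat \<Rightarrow> real"
  where "cdist n k = infdist (complex_of_real (\<mu> k)) (path_image (\<Gamma> n))"

lemma cdist_le: "z \<in> path_image (\<Gamma> n) \<Longrightarrow> cdist n k \<le> cmod (z - \<mu> k)"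
  unfolding cdist_def using infdist_le by (metis dist_commute dist_norm)

lemma cdist_ge:
  assumes "\<And>z. z \<in> path_image (\<Gamma> n) \<Longrightarrow> d \<le> cmod (z - \<mu> k)"
  shows "d \<le> cdist n k"
  unfolding cdist_def infdist_def using assms
  by (auto intro!: cINF_greatest simp: dist_norm norm_minus_commute)

text \<open>The rectangle reaches at most halfway across the guaranteed gap on either side, so the
  real part alone leaves half the distance between the eigenvalues. The left gap belongs to index
  \<open>n - 1\<close>, which explains \<open>Suc N\<^sub>0 \<le> n\<close>.\<close>

lemma cdist_offdiag:
  assumes n: "Suc N\<^sub>0 \<le> n" and k: "1 \<le> k" "k \<noteq> n"
  shows "\<bar>\<mu> n - \<mu> k\<bar> / 2 \<le> cdist n k"
proof (rule cdist_ge)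
  fix z assume "z \<in> path_image (\<Gamma> n)"
  then have z: "\<mu> n - \<kappa> / 2 * (real n - 1) powr (\<gamma> - 1) \<le> Re z"
    "Re z \<le> \<mu> n + \<kappa> / 2 * real n powr (\<gamma> - 1)"
    using n N0_pos by (auto simp: path_image_Gamma in_cbox_complex_iff ll_def ur_def)
  have nonneg: "0 \<le> \<kappa> * (real n - 1) powr (\<gamma> - 1)" "0 \<le> \<kappa> * real n powr (\<gamma> - 1)"
    using kappa_pos by simp_all
  have "\<bar>\<mu> n - \<mu> k\<bar> / 2 \<le> \<bar>Re (z - \<mu> k)\<bar>"
  proof (cases "k < n")
    case True
    have "\<mu> k \<le> \<mu> (n - 1)" using True k by (intro mu_le) auto
    moreover have "\<kappa> * (real n - 1) powr (\<gamma> - 1) \<le> \<mu> n - \<mu> (n - 1)"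
      using gap[of "n - 1"] n by (simp add: of_nat_diff)
    ultimately show ?thesis using z nonneg by simp
  next
    case False
    have "\<mu> (Suc n) \<le> \<mu> k" using False k by (intro mu_le) auto
    moreover have "\<kappa> * real n powr (\<gamma> - 1) \<le> \<mu> (Suc n) - \<mu> n"
      using gap[of n] n by simp
    ultimately show ?thesis using z nonneg by simp
  qed
  also have "\<dots> \<le> cmod (z - \<mu> k)" by (rule abs_Re_le_cmod)
  finally show "\<bar>\<mu> n - \<mu> k\<bar> / 2 \<le> cmod (z - \<mu> k)" .
qed

text \<open>The left side of the rectangle has offset of order
  \<open>(n - 1) powr (\<gamma> - 1)\<close>; rewriting it as a power of \<open>n\<close> produces
  the constant \<open>2 powr \<bar>\<gamma> - 1\<bar>\<close>.\<close>

lemma cdist_diag: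
  assumes n: "2 \<le> n"
  shows "\<kappa> / 2 / 2 powr \<bar>\<gamma> - 1\<bar> * real n powr (\<gamma> - 1) \<le> cdist n n"
proof (rule cdist_ge)
  fix z assume "z \<in> path_image (\<Gamma> n)"
  then have z: "z \<in> cbox (ll n) (ur n)" "z \<notin> box (ll n) (ur n)" using n by (auto simp: path_image_Gamma)
  let ?d = "\<kappa> / 2 / 2 powr \<bar>\<gamma> - 1\<bar> * real n powr (\<gamma> - 1)"
  have d1: "?d \<le> \<kappa> / 2 * (real n - 1) powr (\<gamma> - 1)"
    using powr_pred_le(2)[OF n, of "\<gamma> - 1"] kappa_pos by (simp add: field_simps)
  have "1 \<le> (2::real) powr \<bar>\<gamma> - 1\<bar>" by (simp add: ge_one_powr_ge_zero)
  then have d2: "?d \<le> \<kappa> / 2 * real n powr (\<gamma> - 1)"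
    using kappa_pos by (simp add: field_simps mult_le_cancel_left1)
  \<comment> \<open>A point of the closed box outside the open box lies on one of the four sides,
    where one coordinate attains its full offset.\<close>
  have "?d \<le> \<bar>Re (z - \<mu> n)\<bar> \<or> ?d \<le> \<bar>Im (z - \<mu> n)\<bar>"
    using z d1 d2 by (auto simp: in_cbox_complex_iff in_box_complex_iff ll_def ur_def)
  then show "?d \<le> cmod (z - \<mu> n)"
    using abs_Re_le_cmod[of "z - \<mu> n"] abs_Im_le_cmod[of "z - \<mu> n"] by linarith
qed

text \<open>Collects what later estimates use of the contour geometry. The bound of
  \<open>\<mu> k\<close> by \<open>\<mu> n + 2 * cdist n k\<close> lets one distance factor cancel
  against a large eigenvalue.\<close>

lemma cdist_bounds:
  obtains c where "0 < c"
    "\<And>n k. 2 * N\<^sub>0 \<le> n \<Longrightarrow> 1 \<le> k \<Longrightarrow> 0 < cdist n k"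
    "\<And>n k. 2 * N\<^sub>0 \<le> n \<Longrightarrow> 1 \<le> k \<Longrightarrow> 1 / cdist n k \<le> c * kern \<gamma> n k"
    "\<And>n k. 2 * N\<^sub>0 \<le> n \<Longrightarrow> 1 \<le> k \<Longrightarrow> \<mu> k \<le> \<mu> n + 2 * cdist n k"
    "\<And>n. 2 * N\<^sub>0 \<le> n \<Longrightarrow> real n powr \<gamma> \<le> c * \<mu> n"
proof -
  obtain c where c: "0 < c"
    "\<And>n k. 2 * N\<^sub>0 \<le> n \<Longrightarrow> 1 \<le> k \<Longrightarrow> k \<noteq> n \<Longrightarrow> c \<le> kern \<gamma> n k * \<bar>\<mu> n - \<mu> k\<bar>"
    "\<And>n. 2 * N\<^sub>0 \<le> n \<Longrightarrow> c * real n powr \<gamma> \<le> \<mu> n"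
    using mu_dist_ge by metis
  define d where "d = min (c / 2) (\<kappa> / 2 / 2 powr \<bar>\<gamma> - 1\<bar>)"
  have d: "0 < d" "d \<le> c / 2" "d \<le> c" "d \<le> \<kappa> / 2 / 2 powr \<bar>\<gamma> - 1\<bar>"
    using c kappa_pos by (auto simp: d_def)
  have kern_pos: "0 < kern \<gamma> n k" if "1 \<le> k" for n k
    using that by (auto simp: kern_def max_def)
  have *: "d \<le> kern \<gamma> n k * cdist n k" if nk: "2 * N\<^sub>0 \<le> n" "1 \<le> k" for n k
  proof (cases "k = n")
    case True
    have "d \<le> \<kappa> / 2 / 2 powr \<bar>\<gamma> - 1\<bar>" by fact
    also have "\<dots> = kern \<gamma> n n * (\<kappa> / 2 / 2 powr \<bar>\<gamma> - 1\<bar> * real n powr (\<gamma> - 1))"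
      using nk N0_pos by (simp add: kern_def flip: powr_add)
    also have "\<dots> \<le> kern \<gamma> n n * cdist n n"
      using nk N0_pos by (intro mult_left_mono cdist_diag kern_nonneg) auto
    finally show ?thesis using True by simp
  next
    case False
    have "d \<le> kern \<gamma> n k * (\<bar>\<mu> n - \<mu> k\<bar> / 2)" using c(2)[OF nk False] d by simp
    also have "\<dots> \<le> kern \<gamma> n k * cdist n k"
      using nk False N0_pos by (intro mult_left_mono cdist_offdiag kern_nonneg) auto
    finally show ?thesis .
  qed
  have cdist_pos: "0 < cdist n k" if "2 * N\<^sub>0 \<le> n" "1 \<le> k" for n k
    using *[OF that] d(1) kern_pos[of k n] that by (smt (verit) mult_nonneg_nonpos)
  show thesis
  proof (rule that)
    show "0 < 1 / d" using d by simp
    show "0 < cdist n k" if "2 * N\<^sub>0 \<le> n" "1 \<le> k" for n k by (rule cdist_pos[OF that])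
    show "1 / cdist n k \<le> 1 / d * kern \<gamma> n k" if "2 * N\<^sub>0 \<le> n" "1 \<le> k" for n k
      using *[OF that] d(1) cdist_pos[OF that] by (simp add: field_simps)
    show "\<mu> k \<le> \<mu> n + 2 * cdist n k" if "2 * N\<^sub>0 \<le> n" "1 \<le> k" for n k
      using cdist_offdiag[of n k] cdist_pos[OF that] that N0_pos by (cases "k = n") auto
    show "real n powr \<gamma> \<le> 1 / d * \<mu> n" if "2 * N\<^sub>0 \<le> n" for n
    proof -
      have "d * real n powr \<gamma> \<le> c * real n powr \<gamma>" using d by (intro mult_right_mono) auto
      then show ?thesis using c(3)[OF that] d(1) by (simp add: field_simps)
    qed
  qed
qed

end

section \<open>Integrals over rectangles and the decay of the kernel energy\<close>

lemma rectpath_contour_integral_bound: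
  assumes f: "f contour_integrable_on rectpath a b" and B: "0 \<le> B"
    "\<And>z. z \<in> path_image (rectpath a b) \<Longrightarrow> cmod (f z) \<le> B"
    and ab: "Re a \<le> Re b" "Im a \<le> Im b"
  shows "cmod (contour_integral (rectpath a b) f) \<le> 2 * B * ((Re b - Re a) + (Im b - Im a))"
proof -
  define c d where "c = Complex (Re b) (Im a)" and "d = Complex (Re a) (Im b)"
  let ?I = "\<lambda>x y. contour_integral (linepath x y) f"
  have eq: "rectpath a b = linepath a c +++ linepath c b +++ linepath b d +++ linepath d a"
    by (simp add: rectpath_def Let_def c_def d_def)
  have int: "f contour_integrable_on linepath a c" "f contour_integrable_on linepath c b"
    "f contour_integrable_on linepath b d" "f contour_integrable_on linepath d a"
    using f unfolding eq by auto
  have P: "path_image (rectpath a b) = closed_segment a c \<union> closed_segment c b \<union>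
      closed_segment b d \<union> closed_segment d a"
    unfolding eq by (simp add: path_image_join Un_assoc)
  have sub: "closed_segment a c \<subseteq> path_image (rectpath a b)"
    "closed_segment c b \<subseteq> path_image (rectpath a b)"
    "closed_segment b d \<subseteq> path_image (rectpath a b)"
    "closed_segment d a \<subseteq> path_image (rectpath a b)"
    unfolding P by blast+
  have len: "cmod (c - a) = Re b - Re a" "cmod (b - c) = Im b - Im a"
    "cmod (d - b) = Re b - Re a" "cmod (a - d) = Im b - Im a"
    using ab by (simp_all add: c_def d_def cmod_def)
  have L: "cmod (?I x y) \<le> B * cmod (y - x)"
    if "f contour_integrable_on linepath x y" "closed_segment x y \<subseteq> path_image (rectpath a b)" for x y
    using that B by (intro contour_integral_bound_linepath) auto
  have "cmod (contour_integral (rectpath a b) f) = cmod (?I a c + (?I c b + (?I b d + ?I d a)))"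
    unfolding eq using int by simp
  also have "\<dots> \<le> cmod (?I a c) + (cmod (?I c b) + (cmod (?I b d) + cmod (?I d a)))"
    by (intro order_trans[OF norm_triangle_ineq] add_mono order_refl)
  also have "\<dots> \<le> B * cmod (c - a) + (B * cmod (b - c) + (B * cmod (d - b) + B * cmod (a - d)))"
    by (rule add_mono[OF L[OF int(1) sub(1)] add_mono[OF L[OF int(2) sub(2)]
          add_mono[OF L[OF int(3) sub(3)] L[OF int(4) sub(4)]]]])
  also have "\<dots> = 2 * B * ((Re b - Re a) + (Im b - Im a))"
    by (simp add: len algebra_simps)
  finally show ?thesis .
qed

text \<open>
  This bounds \<open>(\<Sum>k\<in>F. n powr (- 2\<alpha>) * k powr (- 2\<alpha>) * \<mu> k / (d\<^sup>2 * \<mu> n))\<close> up to a constant, where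
  \<open>d\<close> is the distance of \<open>\<mu> k\<close> from the \<open>n\<close>-th contour. The two sums come from
  \<open>\<mu> k \<le> \<mu> n + 2d\<close>, so no upper bound on the growth of \<open>\<mu>\<close> is needed.
\<close>

definition kern_energy :: "real \<Rightarrow> real \<Rightarrow> nat set \<Rightarrow> nat \<Rightarrow> real"
  where "kern_energy \<alpha> \<gamma> F n =
    (\<Sum>k\<in>F. real n powr (- 2 * \<alpha>) * real k powr (- 2 * \<alpha>) * (kern \<gamma> n k)\<^sup>2) +
    real n powr (- 2 * \<alpha> - \<gamma>) * (\<Sum>k\<in>F. real k powr (- 2 * \<alpha>) * kern \<gamma> n k)"

text \<open>The second sum of the energy decays like n powr (- (2\<alpha> + \<gamma> + \<epsilon>)),
  which is faster than 1/n because 2\<alpha> + \<gamma> > 1. Thus only the sum of squares decides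
  between mere decay and summability in \<open>n\<close>.\<close>

lemma kern_energy_le:
  assumes "0 < \<gamma>" "1 < 2 * \<alpha> + \<gamma>"
  obtains \<epsilon> C where "0 < \<epsilon>" "0 < C"
    "\<forall>n\<ge>1. \<forall>F. finite F \<longrightarrow> F \<subseteq> {1..} \<longrightarrow> kern_energy \<alpha> \<gamma> F n \<le> C * real n powr (- \<epsilon>)"
    "3 / 2 < 2 * \<alpha> + \<gamma> \<Longrightarrow> \<exists>\<delta>>0. \<exists>D. \<forall>n\<ge>1. \<forall>F. finite F \<longrightarrow> F \<subseteq> {1..} \<longrightarrow>
      kern_energy \<alpha> \<gamma> F n \<le> D * real n powr (- (1 + \<delta>))"
proof -
  obtain \<epsilon> C where \<epsilon>: "0 < \<epsilon>" "0 < C" and C: "\<And>n F. 1 \<le> n \<Longrightarrow> finite F \<Longrightarrow> F \<subseteq> {1..} \<Longrightarrow>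
      (\<Sum>k\<in>F. real k powr (- 2 * \<alpha>) * kern \<gamma> n k) \<le> C * real n powr (- \<epsilon>)"
    using kern_sum_le[OF assms(1,2)] by metis
  obtain K where K: "0 < K"
    "\<And>n k. 1 \<le> n \<Longrightarrow> 1 \<le> k \<Longrightarrow> real k powr (- 2 * \<alpha>) * kern \<gamma> n k \<le> K"
    using kern_le_const[OF assms(1,2)] by metis
  have G: "real n powr (- 2 * \<alpha> - \<gamma>) * (\<Sum>k\<in>F. real k powr (- 2 * \<alpha>) * kern \<gamma> n k) \<le>
      C * real n powr (- (2 * \<alpha> + \<gamma> + \<epsilon>))" if "1 \<le> n" "finite F" "F \<subseteq> {1..}" for n F
  proof -
    have "real n powr (- 2 * \<alpha> - \<gamma>) * (\<Sum>k\<in>F. real k powr (- 2 * \<alpha>) * kern \<gamma> n k) \<le>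
        real n powr (- 2 * \<alpha> - \<gamma>) * (C * real n powr (- \<epsilon>))"
      by (intro mult_left_mono C that) auto
    also have "\<dots> = C * (real n powr (- 2 * \<alpha> - \<gamma>) * real n powr (- \<epsilon>))"
      by simp
    also have "real n powr (- 2 * \<alpha> - \<gamma>) * real n powr (- \<epsilon>) = real n powr (- (2 * \<alpha> + \<gamma> + \<epsilon>))"
      by (simp flip: powr_add)
    finally show ?thesis .
  qed
  have powr_le: "C * real n powr (- (2 * \<alpha> + \<gamma> + \<epsilon>)) \<le> C * real n powr (- p)"
    if "1 \<le> n" "p \<le> 2 * \<alpha> + \<gamma> + \<epsilon>" for n p
    using that \<epsilon> by (intro mult_left_mono powr_mono) auto
  show thesis
  proof (rule that)
    show "0 < \<epsilon>" "0 < K * C + C" using \<epsilon> K(1) by (simp_all add: add_pos_pos)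
    have "kern_energy \<alpha> \<gamma> F n \<le> (K * C + C) * real n powr (- \<epsilon>)" if nF: "1 \<le> n" "finite F" "F \<subseteq> {1..}" for n F
    proof -
      \<comment> \<open>For decay alone it suffices to bound one of the two kernel factors by the
        constant \<open>K\<close> and to sum the other.\<close>
      have "(\<Sum>k\<in>F. real n powr (- 2 * \<alpha>) * real k powr (- 2 * \<alpha>) * (kern \<gamma> n k)\<^sup>2) =
          (\<Sum>k\<in>F. (real n powr (- 2 * \<alpha>) * kern \<gamma> k n) * (real k powr (- 2 * \<alpha>) * kern \<gamma> n k))"
        by (simp add: kern_commute[of \<gamma> _ n] power2_eq_square mult_ac)
      also have "\<dots> \<le> (\<Sum>k\<in>F. K * (real k powr (- 2 * \<alpha>) * kern \<gamma> n k))"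
        using nF by (intro sum_mono mult_right_mono K(2)) (auto simp: kern_nonneg)
      also have "\<dots> \<le> K * (C * real n powr (- \<epsilon>))"
        using C[OF nF] K(1) by (simp flip: sum_distrib_left)
      finally show ?thesis
        using G[OF nF] powr_le[of n \<epsilon>] nF assms by (simp add: kern_energy_def algebra_simps)
    qed
    then show "\<forall>n\<ge>1. \<forall>F. finite F \<longrightarrow> F \<subseteq> {1..} \<longrightarrow>
      kern_energy \<alpha> \<gamma> F n \<le> (K * C + C) * real n powr (- \<epsilon>)" by blast
    show "\<exists>\<delta>>0. \<exists>D. \<forall>n\<ge>1. \<forall>F. finite F \<longrightarrow> F \<subseteq> {1..} \<longrightarrow> kern_energy \<alpha> \<gamma> F n \<le> D * real n powr (- (1 + \<delta>))"
      if large: "3 / 2 < 2 * \<alpha> + \<gamma>"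
    proof -
      obtain \<delta> D where \<delta>: "0 < \<delta>" "0 < D" and D: "\<And>n F. 1 \<le> n \<Longrightarrow> finite F \<Longrightarrow> F \<subseteq> {1..} \<Longrightarrow>
        (\<Sum>k\<in>F. real n powr (- 2 * \<alpha>) * real k powr (- 2 * \<alpha>) * (kern \<gamma> n k)\<^sup>2) \<le>
        D * real n powr (- (1 + \<delta>))"
        by (rule kern_square_sum_le[OF assms(1) large]) (rule that)
      define \<eta> where "\<eta> = min \<delta> \<epsilon>"
      have \<eta>: "0 < \<eta>" "\<eta> \<le> \<delta>" "\<eta> \<le> \<epsilon>" using \<delta> \<epsilon> by (auto simp: \<eta>_def)
      have "kern_energy \<alpha> \<gamma> F n \<le> (D + C) * real n powr (- (1 + \<eta>))" if nF: "1 \<le> n" "finite F" "F \<subseteq> {1..}" for n F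
      proof -
        have "D * real n powr (- (1 + \<delta>)) \<le> D * real n powr (- (1 + \<eta>))"
          using nF \<delta> \<eta> by (intro mult_left_mono powr_mono) auto
        moreover have "C * real n powr (- (2 * \<alpha> + \<gamma> + \<epsilon>)) \<le> C * real n powr (- (1 + \<eta>))"
          using nF \<eta> assms by (intro powr_le) auto
        ultimately show ?thesis
          using G[OF nF] D[OF nF] by (simp add: kern_energy_def distrib_right)
      qed
      then show ?thesis using \<eta>(1) by blast
    qed
  qed
qed

section \<open>Diagonal forms with a small perturbation\<close>

text \<open>The basis vectors are weak eigenvectors of the form \<open>a\<close>, so everything is
  expressed through forms and coefficients. The operator \<open>T\<close> enters afterwards, through
  a weak equation.\<close>

locale perturbed_form = gap_sequence \<mu> \<gamma> \<kappa> N\<^sub>0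
  for \<mu> :: "nat \<Rightarrow> real" and \<gamma> \<kappa> :: real and N\<^sub>0 :: nat +
  fixes V :: "'a::complex_hilbert_space set" and a b :: "'a \<Rightarrow> 'a \<Rightarrow> complex"
    and \<psi> :: "nat \<Rightarrow> 'a" and \<alpha> M\<^sub>b :: real
  assumes a_sesq: "sesquilinear_on V a" and a_herm: "hermitian_on V a"
    and a_pos: "positive_definite_on V a" and a_closed: "closed_form_on V a"
    and psi_basis: "orthonormal_basis \<psi>"
    and psi_in_V: "\<And>k. 1 \<le> k \<Longrightarrow> \<psi> k \<in> V"
    and a_psi: "\<And>k v. 1 \<le> k \<Longrightarrow> v \<in> V \<Longrightarrow> a (\<psi> k) v = \<mu> k * cinner (\<psi> k) v"
    and b_sesq: "sesquilinear_on V b"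
    and b_cont: "\<exists>C. \<forall>u\<in>V. \<forall>v\<in>V. cmod (b u v) \<le> C * form_norm a u * form_norm a v"
    and Mb_pos: "0 < M\<^sub>b" and alpha_gamma: "1 < 2 * \<alpha> + \<gamma>"
    and b_bound: "\<And>m n. 1 \<le> m \<Longrightarrow> 1 \<le> n \<Longrightarrow>
      cmod (b (\<psi> m) (\<psi> n)) \<le> M\<^sub>b * real m powr (- \<alpha>) * real n powr (- \<alpha>)"
begin

lemma subspace_V: "csubspace V"
  using a_sesq by (simp add: sesquilinear_on_def)

lemma psi_orth: "1 \<le> j \<Longrightarrow> 1 \<le> k \<Longrightarrow> cinner (\<psi> j) (\<psi> k) = (if j = k then 1 else 0)"
  using psi_basis by (simp add: orthonormal_basis_def)

lemma a_psi_right: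
  assumes "u \<in> V" "1 \<le> k"
  shows "a u (\<psi> k) = \<mu> k * cinner u (\<psi> k)"
proof -
  have "a u (\<psi> k) = cnj (a (\<psi> k) u)"
    using a_herm assms psi_in_V unfolding hermitian_on_def by blast
  also have "\<dots> = \<mu> k * cnj (cinner (\<psi> k) u)" using a_psi assms by simp
  also have "cnj (cinner (\<psi> k) u) = cinner u (\<psi> k)" by (rule cinner_commute[symmetric])
  finally show ?thesis .
qed

section \<open>Truncated expansions and the form norm\<close>

definition trunc :: "'a \<Rightarrow> nat \<Rightarrow> 'a"
  where "trunc u M = (\<Sum>k\<in>{1..M}. cinner u (\<psi> k) *\<^sub>C \<psi> k)"

lemma trunc_in_V: "trunc u M \<in> V"
  unfolding trunc_def using psi_in_V
  by (auto intro!: complex_vector.subspace_sum complex_vector.subspace_scale subspace_V)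

lemma cinner_trunc:
  assumes "1 \<le> k"
  shows "cinner (trunc u M) (\<psi> k) = (if k \<le> M then cinner u (\<psi> k) else 0)"
proof -
  have "cinner (trunc u M) (\<psi> k) = (\<Sum>j\<in>{1..M}. cinner u (\<psi> j) * cinner (\<psi> j) (\<psi> k))"
    unfolding trunc_def by (rule sesquilinear_on_sum(1)[OF sesquilinear_on_cinner]) auto
  also have "\<dots> = (\<Sum>j\<in>{1..M}. if k = j then cinner u (\<psi> k) else 0)"
    by (intro sum.cong refl) (use assms psi_orth in auto)
  finally show ?thesis using assms by simp
qed

lemma a_expansion:
  assumes u: "u \<in> V" and F: "finite F" "F \<subseteq> {1..}"
  shows "(form_norm a (u - (\<Sum>k\<in>F. c k *\<^sub>C \<psi> k)))\<^sup>2 =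
    (form_norm a u)\<^sup>2 - (\<Sum>k\<in>F. \<mu> k * (cmod (cinner u (\<psi> k)))\<^sup>2)
    + (\<Sum>k\<in>F. \<mu> k * (cmod (cinner u (\<psi> k) - c k))\<^sup>2)"
proof -
  have p: "(\<Sum>k\<in>F. c k *\<^sub>C \<psi> k) \<in> V"
    using psi_in_V F
    by (auto intro!: complex_vector.subspace_sum complex_vector.subspace_scale subspace_V)
  have k: "1 \<le> k" if "k \<in> F" for k using F that by auto
  show ?thesis
    unfolding form_norm_power2(1)[OF a_sesq a_pos u]
      form_norm_power2(1)[OF a_sesq a_pos complex_vector.subspace_diff[OF subspace_V u p]]
    by (rule form_expansion[OF a_sesq a_herm u F(1)])
      (use k psi_in_V a_psi_right psi_orth u in auto)
qed

lemma sum_le_form_norm: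
  assumes "u \<in> V" "finite F" "F \<subseteq> {1..}"
  shows "(\<Sum>k\<in>F. \<mu> k * (cmod (cinner u (\<psi> k)))\<^sup>2) \<le> (form_norm a u)\<^sup>2"
  using a_expansion[OF assms, of "\<lambda>k. cinner u (\<psi> k)"]
    zero_le_power2[of "form_norm a (u - (\<Sum>k\<in>F. cinner u (\<psi> k) *\<^sub>C \<psi> k))"] by simp

lemma form_norm_diff_trunc:
  assumes "u \<in> V"
  shows "(form_norm a (u - trunc u M))\<^sup>2 =
    (form_norm a u)\<^sup>2 - (\<Sum>k\<in>{1..M}. \<mu> k * (cmod (cinner u (\<psi> k)))\<^sup>2)"
  unfolding trunc_def using a_expansion[OF assms, of "{1..M}" "\<lambda>k. cinner u (\<psi> k)"] by auto

lemma form_norm_minus_commute: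
  assumes "u \<in> V" "v \<in> V"
  shows "form_norm a (u - v) = form_norm a (v - u)"
  using form_norm_scaleR[OF a_sesq complex_vector.subspace_diff[OF subspace_V assms], of "-1"] by simp

text \<open>The weighted sums of squared coefficients increase and are bounded by Bessel's
  inequality, so the truncations are Cauchy in the form norm. They converge to \<open>u\<close> in
  the Hilbert space, and closedness of \<open>a\<close> identifies the limit in the form
  norm.\<close>

lemma trunc_tendsto_form_norm:
  assumes u: "u \<in> V"
  shows "(\<lambda>M. form_norm a (u - trunc u M)) \<longlonglongrightarrow> 0"
proof -
  let ?s = "\<lambda>M. \<Sum>k\<in>{1..M}. \<mu> k * (cmod (cinner u (\<psi> k)))\<^sup>2"
  \<comment> \<open>The Bessel identity is applied to \<open>trunc u n\<close> in place of
    \<open>u\<close>, at levels \<open>m\<close> and \<open>n\<close>; the truncation at level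
    \<open>n\<close> leaves it unchanged.\<close>
  have diff: "(form_norm a (trunc u n - trunc u m))\<^sup>2 = ?s n - ?s m" if "m \<le> n" for m n
  proof -
    have tr: "trunc (trunc u n) k = trunc u k" if "k \<le> n" for k
      unfolding trunc_def[of _ k] using that
      by (intro sum.cong refl) (auto simp: cinner_trunc)
    have s: "(\<Sum>j\<in>{1..k}. \<mu> j * (cmod (cinner (trunc u n) (\<psi> j)))\<^sup>2) = ?s k" if "k \<le> n" for k
      using that by (intro sum.cong refl) (auto simp: cinner_trunc)
    have "form_norm a 0 = 0"
      using form_norm_scaleR[OF a_sesq u, of 0] by simp
    then show ?thesis
      using form_norm_diff_trunc[OF trunc_in_V, of u n n] form_norm_diff_trunc[OF trunc_in_V, of u n m]
        that tr[of m] tr[of n] s[of m] s[of n] by simp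
  qed
  have diff': "(form_norm a (trunc u n - trunc u m))\<^sup>2 = \<bar>?s n - ?s m\<bar>" for m n
  proof (cases "m \<le> n")
    case True
    then show ?thesis
      using diff[OF True] zero_le_power2[of "form_norm a (trunc u n - trunc u m)"] by linarith
  next
    case False
    then have "(form_norm a (trunc u n - trunc u m))\<^sup>2 = ?s m - ?s n"
      using diff[of n m] form_norm_minus_commute[OF trunc_in_V trunc_in_V, of u n u m] by simp
    then show ?thesis
      using zero_le_power2[of "form_norm a (trunc u n - trunc u m)"] by linarith
  qed
  \<comment> \<open>Closedness is phrased with the modulus of the quadratic form; by hermitian
    symmetry and positivity this is the squared form norm.\<close>
  have real: "cmod (a w w) = (form_norm a w)\<^sup>2" if w: "w \<in> V" for w
  proof -
    have "a w w = cnj (a w w)" using a_herm w unfolding hermitian_on_def by blast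
    from arg_cong[OF this, of Im] have "Im (a w w) = 0" by simp
    then have "cmod (a w w) = \<bar>Re (a w w)\<bar>" by (simp add: cmod_eq_Re)
    then show ?thesis using form_norm_power2(1)[OF a_sesq a_pos w] by (metis abs_of_nonneg zero_le_power2)
  qed
  have "Bseq ?s"
  proof (rule BseqI')
    have "0 \<le> ?s M" for M
      using mu_gt_0 by (intro sum_nonneg mult_nonneg_nonneg) (auto intro: less_imp_le)
    then show "norm (?s M) \<le> (form_norm a u)\<^sup>2" for M
      using sum_le_form_norm[OF u, of "{1..M}"] by (simp add: abs_of_nonneg)
  qed
  moreover have "incseq ?s"
    using mu_gt_0 by (intro incseq_SucI) (simp add: less_imp_le)
  ultimately have "Cauchy ?s"
    by (intro convergent_Cauchy Bseq_monoseq_convergent) (auto simp: monoseq_iff)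
  moreover have "cmod (a (trunc u n - trunc u m) (trunc u n - trunc u m)) = dist (?s n) (?s m)" for m n
    using real[OF complex_vector.subspace_diff[OF subspace_V trunc_in_V trunc_in_V]]
    by (simp only: diff' dist_real_def)
  ultimately have "\<forall>e>0. \<exists>M. \<forall>m\<ge>M. \<forall>n\<ge>M.
      cmod (a (trunc u n - trunc u m) (trunc u n - trunc u m)) < e"
    unfolding Cauchy_def by (simp only:) blast
  moreover have "trunc u \<longlonglongrightarrow> u"
    using orthonormal_basis_expansion[OF psi_basis, of u] by (simp add: trunc_def[abs_def])
  ultimately have "(\<lambda>n. a (trunc u n - u) (trunc u n - u)) \<longlonglongrightarrow> 0"
    using a_closed trunc_in_V unfolding closed_form_on_def by blast
  then have "(\<lambda>n. sqrt (Re (a (trunc u n - u) (trunc u n - u)))) \<longlonglongrightarrow> sqrt (Re 0)"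
    by (intro tendsto_intros)
  then have "(\<lambda>n. form_norm a (trunc u n - u)) \<longlonglongrightarrow> 0"
    by (simp add: form_norm_def)
  then show ?thesis by (simp add: form_norm_minus_commute[OF u trunc_in_V])
qed

text \<open>The remaining half of Parseval's identity: the squared form norm equals the truncated
  sum plus an error that tends to 0.\<close>

lemma form_norm_le:
  assumes u: "u \<in> V"
    and B: "\<And>F. finite F \<Longrightarrow> F \<subseteq> {1..} \<Longrightarrow> (\<Sum>k\<in>F. \<mu> k * (cmod (cinner u (\<psi> k)))\<^sup>2) \<le> B"
  shows "(form_norm a u)\<^sup>2 \<le> B"
proof -
  have lim: "(\<lambda>M. B + (form_norm a (u - trunc u M))\<^sup>2) \<longlonglongrightarrow> B + 0\<^sup>2"
    by (intro tendsto_intros trunc_tendsto_form_norm u)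
  have "(form_norm a u)\<^sup>2 \<le> B + (form_norm a (u - trunc u M))\<^sup>2" for M
    using form_norm_diff_trunc[OF u, of M] B[of "{1..M}"] by simp
  then show ?thesis using LIMSEQ_le_const[OF lim, of "(form_norm a u)\<^sup>2"] by simp
qed

text \<open>On truncations the matrix bound for \<open>b\<close> applies term by term; continuity of
  \<open>b\<close> in the form norm passes to the limit.\<close>

lemma b_psi_le:
  assumes u: "u \<in> V" and k: "1 \<le> k"
    and S: "\<And>F. finite F \<Longrightarrow> F \<subseteq> {1..} \<Longrightarrow> (\<Sum>m\<in>F. cmod (cinner u (\<psi> m)) * real m powr (- \<alpha>)) \<le> S"
  shows "cmod (b u (\<psi> k)) \<le> M\<^sub>b * real k powr (- \<alpha>) * S"
proof -
  from b_cont obtain C where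
    C: "\<forall>u\<in>V. \<forall>v\<in>V. cmod (b u v) \<le> C * form_norm a u * form_norm a v" ..
  have lim: "(\<lambda>M. M\<^sub>b * real k powr (- \<alpha>) * S + C * form_norm a (u - trunc u M) * form_norm a (\<psi> k))
      \<longlonglongrightarrow> M\<^sub>b * real k powr (- \<alpha>) * S + C * 0 * form_norm a (\<psi> k)"
    by (intro tendsto_intros trunc_tendsto_form_norm u)
  have "cmod (b u (\<psi> k)) \<le>
      M\<^sub>b * real k powr (- \<alpha>) * S + C * form_norm a (u - trunc u M) * form_norm a (\<psi> k)" for M
  proof -
    have "b u (\<psi> k) = b (trunc u M) (\<psi> k) + b (u - trunc u M) (\<psi> k)"
      using sesquilinear_on_diff(1)[OF b_sesq u trunc_in_V psi_in_V[OF k]] by simp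
    then have "cmod (b u (\<psi> k)) \<le> cmod (b (trunc u M) (\<psi> k)) + cmod (b (u - trunc u M) (\<psi> k))"
      by (metis norm_triangle_ineq)
    moreover have "cmod (b (u - trunc u M) (\<psi> k)) \<le> C * form_norm a (u - trunc u M) * form_norm a (\<psi> k)"
      by (intro C[rule_format] complex_vector.subspace_diff subspace_V u trunc_in_V psi_in_V k)
    moreover have "cmod (b (trunc u M) (\<psi> k)) \<le> M\<^sub>b * real k powr (- \<alpha>) * S"
    proof -
      have "b (trunc u M) (\<psi> k) = (\<Sum>m\<in>{1..M}. cinner u (\<psi> m) * b (\<psi> m) (\<psi> k))"
        unfolding trunc_def
        by (rule sesquilinear_on_sum(1)[OF b_sesq psi_in_V[OF k]]) (auto intro: psi_in_V)
      then have "cmod (b (trunc u M) (\<psi> k)) \<le> (\<Sum>m\<in>{1..M}. cmod (cinner u (\<psi> m) * b (\<psi> m) (\<psi> k)))"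
        by (simp add: norm_sum)
      also have "\<dots> \<le> (\<Sum>m\<in>{1..M}. cmod (cinner u (\<psi> m)) *
          (M\<^sub>b * real m powr (- \<alpha>) * real k powr (- \<alpha>)))"
        unfolding norm_mult using k by (intro sum_mono mult_left_mono b_bound) auto
      also have "\<dots> = M\<^sub>b * real k powr (- \<alpha>) *
          (\<Sum>m\<in>{1..M}. cmod (cinner u (\<psi> m)) * real m powr (- \<alpha>))"
        by (simp add: sum_distrib_left mult_ac)
      also have "\<dots> \<le> M\<^sub>b * real k powr (- \<alpha>) * S"
        using Mb_pos by (intro mult_left_mono S) auto
      finally show ?thesis .
    qed
    ultimately show ?thesis by linarith
  qed
  then show ?thesis using LIMSEQ_le_const[OF lim, of "cmod (b u (\<psi> k))"] by simp
qed

text \<open>Finiteness of this sum must be known before it can be absorbed into the left-hand side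
  of its own estimate. A weighted arithmetic-geometric inequality splits each term into a part of
  the squared form norm and a term of order m powr (- (2\<alpha> + \<gamma>)), whose exponent is
  below -1.\<close>

lemma coefficients_summable:
  assumes u: "u \<in> V"
  shows "(\<lambda>m. cmod (cinner u (\<psi> m)) * real m powr (- \<alpha>)) summable_on {1..}"
proof (rule nonneg_bdd_above_summable_on)
  obtain c where c: "0 < c" "\<And>n. 2 * N\<^sub>0 \<le> n \<Longrightarrow> real n powr \<gamma> \<le> c * \<mu> n"
    using cdist_bounds by metis
  \<comment> \<open>The second entry covers the finitely many indices below
    \<open>2 * N\<^sub>0\<close>, where the gap condition gives no growth bound.\<close>
  define C where "C = max c (real (2 * N\<^sub>0) powr \<gamma> / \<mu> 1)"
  have growth: "real m powr \<gamma> \<le> C * \<mu> m" if m: "1 \<le> m" for m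
  proof (cases "2 * N\<^sub>0 \<le> m")
    case True
    have "c * \<mu> m \<le> C * \<mu> m" using mu_gt_0[OF m] by (intro mult_right_mono) (auto simp: C_def)
    then show ?thesis using c(2)[OF True] by simp
  next
    case False
    have "real m powr \<gamma> \<le> real (2 * N\<^sub>0) powr \<gamma>" using False gamma_pos by (intro powr_mono2) auto
    also have "\<dots> = real (2 * N\<^sub>0) powr \<gamma> / \<mu> 1 * \<mu> 1" using mu_pos by simp
    also have "\<dots> \<le> C * \<mu> m"
      using mu_le[of 1 m] mu_pos m c(1) by (intro mult_mono) (auto simp: C_def)
    finally show ?thesis .
  qed
  obtain Z where Z: "\<And>F. finite F \<Longrightarrow> F \<subseteq> {1..} \<Longrightarrow> (\<Sum>k\<in>F. real k powr (- (2 * \<alpha> + \<gamma>))) \<le> Z"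
    using sum_powr_le[OF alpha_gamma] by metis
  have C: "0 < C" using c(1) by (simp add: C_def)
  have summand_le: "cmod (cinner u (\<psi> m)) * real m powr (- \<alpha>) \<le>
      \<mu> m * (cmod (cinner u (\<psi> m)))\<^sup>2 + C * real m powr (- (2 * \<alpha> + \<gamma>))" if m: "1 \<le> m" for m
  proof -
    let ?x = "cmod (cinner u (\<psi> m))" and ?y = "real m powr (- \<alpha>)"
    have "?x * ?y \<le> \<mu> m * ?x\<^sup>2 + ?y\<^sup>2 / \<mu> m"
    proof -
      \<comment> \<open>Adding the nonnegative mixed term to the square changes its coefficient from
        -2 to -1; after division by \<open>\<mu> m\<close> the desired inequality appears.\<close>
      have "0 \<le> (\<mu> m * ?x - ?y)\<^sup>2 + \<mu> m * ?x * ?y"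
        using mu_gt_0[OF m] by simp
      also have "\<dots> = \<mu> m * (\<mu> m * ?x\<^sup>2 + ?y\<^sup>2 / \<mu> m - ?x * ?y)"
        using mu_gt_0[OF m] by (simp add: power2_eq_square field_simps)
      finally show ?thesis using mu_gt_0[OF m] by (simp add: zero_le_mult_iff)
    qed
    moreover have "?y\<^sup>2 / \<mu> m \<le> C * real m powr (- (2 * \<alpha> + \<gamma>))"
    proof -
      have "?y\<^sup>2 * 1 = real m powr (- (2 * \<alpha> + \<gamma>)) * real m powr \<gamma>"
        using m by (simp add: power2_eq_square flip: powr_add)
      also have "\<dots> \<le> real m powr (- (2 * \<alpha> + \<gamma>)) * (C * \<mu> m)"
        by (intro mult_left_mono growth m) auto
      finally show ?thesis using mu_gt_0[OF m] by (simp add: pos_divide_le_eq mult_ac)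
    qed
    ultimately show ?thesis by linarith
  qed
  show "bdd_above (sum (\<lambda>m. cmod (cinner u (\<psi> m)) * real m powr (- \<alpha>)) ` {F. F \<subseteq> {1..} \<and> finite F})"
  proof (rule bdd_aboveI2)
    fix F :: "nat set" assume "F \<in> {F. F \<subseteq> {1..} \<and> finite F}"
    then have F: "finite F" "F \<subseteq> {1..}" by auto
    have "(\<Sum>m\<in>F. cmod (cinner u (\<psi> m)) * real m powr (- \<alpha>)) \<le>
        (\<Sum>m\<in>F. \<mu> m * (cmod (cinner u (\<psi> m)))\<^sup>2 + C * real m powr (- (2 * \<alpha> + \<gamma>)))"
      using F by (intro sum_mono summand_le) auto
    also have "\<dots> = (\<Sum>m\<in>F. \<mu> m * (cmod (cinner u (\<psi> m)))\<^sup>2) +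
        C * (\<Sum>m\<in>F. real m powr (- (2 * \<alpha> + \<gamma>)))"
      by (simp add: sum.distrib sum_distrib_left)
    also have "\<dots> \<le> (form_norm a u)\<^sup>2 + C * Z"
      using C by (intro add_mono sum_le_form_norm u F mult_left_mono Z) auto
    finally show "(\<Sum>m\<in>F. cmod (cinner u (\<psi> m)) * real m powr (- \<alpha>)) \<le> (form_norm a u)\<^sup>2 + C * Z" .
  qed
qed simp

end

context perturbed_form
begin

section \<open>Resolvent and Riesz projection of a basis vector\<close>

text \<open>The weak form of (z - T) u = \<open>\<psi> n\<close>, tested against all of
  \<open>V\<close>. It frees the estimates from the graph of \<open>T\<close> and from the definite
  description in \<open>resolvent\<close>.\<close>

definition resolvent_eq :: "nat \<Rightarrow> complex \<Rightarrow> 'a \<Rightarrow> bool"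
  where "resolvent_eq n z u \<longleftrightarrow>
    u \<in> V \<and> (\<forall>v\<in>V. a u v + b u v = z * cinner u v - cinner (\<psi> n) v)"

lemma resolvent_eq_coefficient:
  assumes "resolvent_eq n z u" "1 \<le> n" "1 \<le> k" "z \<noteq> \<mu> k"
  shows "cinner u (\<psi> k) - (if k = n then 1 / (z - \<mu> n) else 0) = b u (\<psi> k) / (z - \<mu> k)"
proof -
  have "\<mu> k * cinner u (\<psi> k) + b u (\<psi> k) = z * cinner u (\<psi> k) - (if k = n then 1 else 0)"
    using assms psi_in_V[of k] a_psi_right[of u k] psi_orth[of n k] by (auto simp: resolvent_eq_def)
  then have "(z - \<mu> k) * cinner u (\<psi> k) = (if k = n then 1 else 0) + b u (\<psi> k)"
    by (simp add: algebra_simps)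
  then have "cinner u (\<psi> k) = ((if k = n then 1 else 0) + b u (\<psi> k)) / (z - \<mu> k)"
    using assms(4) by (simp add: eq_divide_eq mult.commute)
  then show ?thesis by (auto simp: add_divide_distrib)
qed

text \<open>Absorption argument: inserting the coefficient equation into the weighted sum
  \<open>S\<close> reproduces \<open>S\<close> with a factor below 1/2, so \<open>S\<close> is at
  most twice the contribution of the diagonal term.\<close>

lemma resolvent_coefficient_le:
  obtains C N\<^sub>1 where "0 < C" "2 * N\<^sub>0 \<le> N\<^sub>1"
    "\<And>n z u k. N\<^sub>1 \<le> n \<Longrightarrow> z \<in> path_image (\<Gamma> n) \<Longrightarrow> resolvent_eq n z u \<Longrightarrow> 1 \<le> k \<Longrightarrow>
      cmod (cinner u (\<psi> k) - (if k = n then 1 / (z - \<mu> n) else 0)) \<le>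
        C * real n powr (- \<alpha>) * real n powr (1 - \<gamma>) * real k powr (- \<alpha>) / cdist n k"
proof -
  obtain c where c: "0 < c"
    "\<And>n k. 2 * N\<^sub>0 \<le> n \<Longrightarrow> 1 \<le> k \<Longrightarrow> 0 < cdist n k"
    "\<And>n k. 2 * N\<^sub>0 \<le> n \<Longrightarrow> 1 \<le> k \<Longrightarrow> 1 / cdist n k \<le> c * kern \<gamma> n k"
    using cdist_bounds by metis
  obtain \<epsilon> K where \<epsilon>: "0 < \<epsilon>" "0 < K" and K: "\<And>n F. 1 \<le> n \<Longrightarrow> finite F \<Longrightarrow> F \<subseteq> {1..} \<Longrightarrow>
      (\<Sum>k\<in>F. real k powr (- 2 * \<alpha>) * kern \<gamma> n k) \<le> K * real n powr (- \<epsilon>)"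
    using kern_sum_le[OF gamma_pos alpha_gamma] by metis
  \<comment> \<open>This is the factor with which \<open>S\<close> returns in its own estimate;
    \<open>N\<^sub>2\<close> is chosen so that it is below 1/2 from there on.\<close>
  have "(\<lambda>n. M\<^sub>b * c * K * real n powr (- \<epsilon>)) \<longlonglongrightarrow> M\<^sub>b * c * K * 0"
    using \<epsilon> by (intro tendsto_intros tendsto_neg_powr filterlim_real_sequentially) auto
  then have "\<forall>\<^sub>F n in sequentially. M\<^sub>b * c * K * real n powr (- \<epsilon>) < 1 / 2"
    by (rule order_tendstoD) simp
  then obtain N\<^sub>2 where N2: "\<And>n. N\<^sub>2 \<le> n \<Longrightarrow> M\<^sub>b * c * K * real n powr (- \<epsilon>) < 1 / 2"
    by (auto simp: eventually_sequentially)
  show thesis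
  proof (rule that)
    show "0 < M\<^sub>b * (2 * c)" "2 * N\<^sub>0 \<le> max (2 * N\<^sub>0) N\<^sub>2" using Mb_pos c by auto
    fix n k :: nat and z :: complex and u :: 'a
    assume "max (2 * N\<^sub>0) N\<^sub>2 \<le> n" and z: "z \<in> path_image (\<Gamma> n)"
      and u: "resolvent_eq n z u" and k: "1 \<le> k"
    then have n: "2 * N\<^sub>0 \<le> n" "N\<^sub>2 \<le> n" "1 \<le> n" using N0_pos by auto
    have uV: "u \<in> V" using u by (simp add: resolvent_eq_def)
    define S where "S = infsum (\<lambda>m. cmod (cinner u (\<psi> m)) * real m powr (- \<alpha>)) {1..}"
    note summ = coefficients_summable[OF uV]
    have S: "(\<Sum>m\<in>F. cmod (cinner u (\<psi> m)) * real m powr (- \<alpha>)) \<le> S"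
      if "finite F" "F \<subseteq> {1..}" for F
      unfolding S_def using that by (intro finite_sum_le_infsum summ) auto
    have S0: "0 \<le> S" using S[of "{}"] by simp
    have b_le: "cmod (b u (\<psi> j)) \<le> M\<^sub>b * real j powr (- \<alpha>) * S" if "1 \<le> j" for j
      using S that by (intro b_psi_le uV) auto
    have pos: "0 < cmod (z - \<mu> j)" "1 / cmod (z - \<mu> j) \<le> 1 / cdist n j" if "1 \<le> j" for j
    proof -
      have "0 < cdist n j" "cdist n j \<le> cmod (z - \<mu> j)" using c(2)[OF n(1) that] cdist_le[OF z] by auto
      then show "0 < cmod (z - \<mu> j)" "1 / cmod (z - \<mu> j) \<le> 1 / cdist n j"
        by (auto intro!: divide_left_mono mult_pos_pos)
    qed
    have coef: "cmod (cinner u (\<psi> j) - (if j = n then 1 / (z - \<mu> n) else 0)) \<le>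
        M\<^sub>b * real j powr (- \<alpha>) * S * (1 / cdist n j)" if j: "1 \<le> j" for j
    proof -
      have "z \<noteq> \<mu> j" using pos(1)[OF j] by auto
      then have "cmod (cinner u (\<psi> j) - (if j = n then 1 / (z - \<mu> n) else 0)) =
          cmod (b u (\<psi> j)) * (1 / cmod (z - \<mu> j))"
        using resolvent_eq_coefficient[OF u n(3) j] by (simp add: norm_divide)
      also have "\<dots> \<le> M\<^sub>b * real j powr (- \<alpha>) * S * (1 / cdist n j)"
        using b_le[OF j] pos(2)[OF j] Mb_pos S0 by (intro mult_mono) auto
      finally show ?thesis .
    qed
    \<comment> \<open>Bound for the weighted diagonal term \<open>1 / (z - \<mu> n)\<close>: on the
      diagonal the kernel equals \<open>n powr (1 - \<gamma>)\<close>.\<close>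
    define L where "L = real n powr (- \<alpha>) * (c * real n powr (1 - \<gamma>))"
    have "S \<le> L + S / 2"
      unfolding S_def
    proof (rule infsum_le_finite_sums[OF summ])
      fix F :: "nat set" assume F: "finite F" "F \<subseteq> {1..}"
      have "(\<Sum>m\<in>F. cmod (cinner u (\<psi> m)) * real m powr (- \<alpha>)) \<le>
          (\<Sum>m\<in>F. (if m = n then L else 0) +
            M\<^sub>b * S * c * (real m powr (- 2 * \<alpha>) * kern \<gamma> n m))"
      proof (rule sum_mono)
        fix m assume "m \<in> F"
        then have m: "1 \<le> m" using F by auto
        have "cmod (cinner u (\<psi> m)) \<le> cmod (if m = n then 1 / (z - \<mu> n) else 0) +
            cmod (cinner u (\<psi> m) - (if m = n then 1 / (z - \<mu> n) else 0))"
          by (rule norm_triangle_sub)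
        also have "\<dots> \<le> (if m = n then c * real n powr (1 - \<gamma>) else 0) +
            M\<^sub>b * real m powr (- \<alpha>) * S * (c * kern \<gamma> n m)"
        proof (rule add_mono)
          have "1 / cmod (z - \<mu> n) \<le> c * real n powr (1 - \<gamma>)"
            using pos(2)[OF n(3)] c(3)[OF n(1) n(3)] by (simp add: kern_def)
          then show "cmod (if m = n then 1 / (z - \<mu> n) else 0) \<le>
              (if m = n then c * real n powr (1 - \<gamma>) else 0)" by (simp add: norm_divide)
          have "M\<^sub>b * real m powr (- \<alpha>) * S * (1 / cdist n m) \<le>
              M\<^sub>b * real m powr (- \<alpha>) * S * (c * kern \<gamma> n m)"
            using c(3)[OF n(1) m] Mb_pos S0 by (intro mult_left_mono) auto
          then show "cmod (cinner u (\<psi> m) - (if m = n then 1 / (z - \<mu> n) else 0)) \<le>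
              M\<^sub>b * real m powr (- \<alpha>) * S * (c * kern \<gamma> n m)" using coef[OF m] by linarith
        qed
        finally have "cmod (cinner u (\<psi> m)) * real m powr (- \<alpha>) \<le>
            ((if m = n then c * real n powr (1 - \<gamma>) else 0) +
              M\<^sub>b * real m powr (- \<alpha>) * S * (c * kern \<gamma> n m)) * real m powr (- \<alpha>)"
          by (intro mult_right_mono) auto
        also have "\<dots> = (if m = n then L else 0) +
            M\<^sub>b * S * c * ((real m powr (- \<alpha>) * real m powr (- \<alpha>)) * kern \<gamma> n m)"
          by (auto simp: L_def algebra_simps)
        also have "real m powr (- \<alpha>) * real m powr (- \<alpha>) = real m powr (- 2 * \<alpha>)"
          by (simp flip: powr_add)
        finally show "cmod (cinner u (\<psi> m)) * real m powr (- \<alpha>) \<le> (if m = n then L else 0) +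
            M\<^sub>b * S * c * (real m powr (- 2 * \<alpha>) * kern \<gamma> n m)" .
      qed
      also have "\<dots> = (\<Sum>m\<in>F. if m = n then L else 0) +
          M\<^sub>b * S * c * (\<Sum>m\<in>F. real m powr (- 2 * \<alpha>) * kern \<gamma> n m)"
        by (simp add: sum.distrib sum_distrib_left)
      also have "\<dots> \<le> L + M\<^sub>b * S * c * (K * real n powr (- \<epsilon>))"
        using K[OF n(3) F] Mb_pos S0 c(1) F(1)
        by (intro add_mono mult_left_mono) (auto simp: L_def sum.delta)
      also have "M\<^sub>b * S * c * (K * real n powr (- \<epsilon>)) = S * (M\<^sub>b * c * K * real n powr (- \<epsilon>))"
        by simp
      also have "\<dots> \<le> S * (1 / 2)"
        using N2[OF n(2)] S0 by (intro mult_left_mono) auto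
      finally show "(\<Sum>m\<in>F. cmod (cinner u (\<psi> m)) * real m powr (- \<alpha>)) \<le>
          L + infsum (\<lambda>m. cmod (cinner u (\<psi> m)) * real m powr (- \<alpha>)) {1..} / 2"
        by (simp add: S_def)
    qed
    then have "S \<le> 2 * L" by simp
    then have "M\<^sub>b * real k powr (- \<alpha>) * S * (1 / cdist n k) \<le>
        M\<^sub>b * real k powr (- \<alpha>) * (2 * L) * (1 / cdist n k)"
      using Mb_pos c(2)[OF n(1) k] by (intro mult_right_mono mult_left_mono) auto
    also have "\<dots> = M\<^sub>b * (2 * c) * real n powr (- \<alpha>) * real n powr (1 - \<gamma>) *
        real k powr (- \<alpha>) / cdist n k"
      by (simp add: L_def)
    finally show "cmod (cinner u (\<psi> k) - (if k = n then 1 / (z - \<mu> n) else 0)) \<le>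
        M\<^sub>b * (2 * c) * real n powr (- \<alpha>) * real n powr (1 - \<gamma>) * real k powr (- \<alpha>) / cdist n k"
      using coef[OF k] by linarith
  qed
qed

text \<open>Taking a coefficient is a bounded linear map and passes under the integral. The
  subtracted pole integrates to 2 pi i, since the rectangle winds once around
  \<open>\<mu> n\<close>. Thus the coefficient of the projection minus the basis vector is a single
  scalar contour integral.\<close>

lemma contour_coefficient:
  assumes n: "2 \<le> n" and k: "1 \<le> k" and nz: "vector_contour_integral (\<Gamma> n) R \<noteq> 0"
  shows "((\<lambda>z. cinner (R z) (\<psi> k) - (if k = n then 1 / (z - \<mu> n) else 0)) has_contour_integral
    cinner (vector_contour_integral (\<Gamma> n) R) (\<psi> k) - (if k = n then 2 * of_real pi * \<i> else 0)) (\<Gamma> n)"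
proof -
  let ?f = "\<lambda>t. vector_derivative (\<Gamma> n) (at t within {0..1}) *\<^sub>C R (\<Gamma> n t)"
  \<comment> \<open>A non-integrable integrand would give the junk value \<open>0\<close>.\<close>
  have "?f integrable_on {0..1}"
    using nz unfolding vector_contour_integral_def by (metis not_integrable_integral)
  then have "(?f has_integral vector_contour_integral (\<Gamma> n) R) {0..1}"
    by (simp add: vector_contour_integral_def integrable_integral)
  then have "((\<lambda>u. cinner u (\<psi> k)) \<circ> ?f has_integral
      cinner (vector_contour_integral (\<Gamma> n) R) (\<psi> k)) {0..1}"
    by (rule has_integral_linear[OF _ bounded_linear_cinner_basis[OF psi_basis k]])
  then have 1: "((\<lambda>z. cinner (R z) (\<psi> k)) has_contour_integral
      cinner (vector_contour_integral (\<Gamma> n) R) (\<psi> k)) (\<Gamma> n)"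
    by (simp add: has_contour_integral_def o_def cinner_scaleC_left mult.commute)
  have 2: "((\<lambda>z. if k = n then 1 / (z - \<mu> n) else 0) has_contour_integral
      (if k = n then 2 * of_real pi * \<i> else 0)) (\<Gamma> n)"
  proof (cases "k = n")
    case True
    have "complex_of_real (\<mu> n) \<notin> path_image (\<Gamma> n)"
      using mu_in_box[OF n] path_image_Gamma[OF n] by auto
    then have "((\<lambda>z. 1 / (z - \<mu> n)) has_contour_integral
        2 * of_real pi * \<i> * winding_number (\<Gamma> n) (\<mu> n)) (\<Gamma> n)"
      using has_contour_integral_winding_number[of "\<Gamma> n" "complex_of_real (\<mu> n)"]
      by (simp add: Gamma_eq)
    then show ?thesis
      using True winding_number_rectpath[OF mu_in_box[OF n]] by (simp add: Gamma_eq)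
  next
    case False
    then show ?thesis by (simp add: has_contour_integral_0)
  qed
  show ?thesis by (rule has_contour_integral_diff[OF 1 2])
qed

text \<open>Here \<open>p\<close> is the Riesz projection applied to \<open>\<psi> n\<close>, for
  any family \<open>R\<close> of weak solutions along the contour. The condition that
  \<open>p\<close> is nonzero secures integrability in \<open>contour_coefficient\<close>.\<close>

definition riesz_projection :: "nat \<Rightarrow> (complex \<Rightarrow> 'a) \<Rightarrow> 'a \<Rightarrow> bool"
  where "riesz_projection n R p \<longleftrightarrow>
    (\<forall>z\<in>path_image (\<Gamma> n). resolvent_eq n z (R z)) \<and> p \<in> V \<and> p \<noteq> 0 \<and>
    p = (1 / (2 * complex_of_real pi * \<i>)) *\<^sub>C vector_contour_integral (\<Gamma> n) R"

text \<open>The perimeter is of order n powr (\<gamma> - 1) and cancels the factor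
  \<open>n powr (1 - \<gamma>)\<close> of the pointwise resolvent estimate.\<close>

lemma projection_coefficient_le:
  obtains C N\<^sub>1 where "0 < C" "2 * N\<^sub>0 \<le> N\<^sub>1"
    "\<And>n R p k. N\<^sub>1 \<le> n \<Longrightarrow> riesz_projection n R p \<Longrightarrow> 1 \<le> k \<Longrightarrow> cmod (cinner (p - \<psi> n) (\<psi> k)) \<le>
        C * real n powr (- \<alpha>) * real k powr (- \<alpha>) / cdist n k"
proof -
  obtain C N\<^sub>1 where C: "0 < C" and N1: "2 * N\<^sub>0 \<le> N\<^sub>1" and le:
    "\<And>n z u k. N\<^sub>1 \<le> n \<Longrightarrow> z \<in> path_image (\<Gamma> n) \<Longrightarrow> resolvent_eq n z u \<Longrightarrow> 1 \<le> k \<Longrightarrow>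
      cmod (cinner u (\<psi> k) - (if k = n then 1 / (z - \<mu> n) else 0)) \<le>
        C * real n powr (- \<alpha>) * real n powr (1 - \<gamma>) * real k powr (- \<alpha>) / cdist n k"
    using resolvent_coefficient_le by metis
  obtain c where c: "\<And>n k. 2 * N\<^sub>0 \<le> n \<Longrightarrow> 1 \<le> k \<Longrightarrow> 0 < cdist n k"
    using cdist_bounds by metis
  \<comment> \<open>Constant for half the perimeter: the left offset contributes
    \<open>2 powr \<bar>\<gamma> - 1\<bar>\<close>, the right offset 1 and the height 2, all in
    units of \<open>\<kappa> / 2\<close>.\<close>
  define P where "P = \<kappa> / 2 * (2 powr \<bar>\<gamma> - 1\<bar> + 3)"
  have P: "0 < P" using kappa_pos by (simp add: P_def add_pos_pos)
  show thesis
  proof (rule that)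
    show "0 < C * P" "2 * N\<^sub>0 \<le> N\<^sub>1" using C P N1 by auto
    fix n k :: nat and R p
    assume n: "N\<^sub>1 \<le> n" and proj: "riesz_projection n R p" and k: "1 \<le> k"
    have R: "\<And>z. z \<in> path_image (\<Gamma> n) \<Longrightarrow> resolvent_eq n z (R z)"
      and p: "p = (1 / (2 * complex_of_real pi * \<i>)) *\<^sub>C vector_contour_integral (\<Gamma> n) R"
      and nz: "p \<noteq> 0" using proj unfolding riesz_projection_def by blast+
    have n2: "2 \<le> n" "2 * N\<^sub>0 \<le> n" using n N1 N0_pos by auto
    define B where "B = C * real n powr (- \<alpha>) * real n powr (1 - \<gamma>) * real k powr (- \<alpha>) / cdist n k"
    define I where "I = vector_contour_integral (\<Gamma> n) R"
    let ?f = "\<lambda>z. cinner (R z) (\<psi> k) - (if k = n then 1 / (z - \<mu> n) else 0)"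
    let ?J = "cinner I (\<psi> k) - (if k = n then 2 * of_real pi * \<i> else 0)"
    have "I \<noteq> 0" using nz p by (auto simp: I_def complex_vector.scale_zero_right)
    then have J: "(?f has_contour_integral ?J) (\<Gamma> n)"
      unfolding I_def by (intro contour_coefficient n2 k)
    have ll_ur: "Re (ur n) - Re (ll n) = \<kappa> / 2 * ((real n - 1) powr (\<gamma> - 1) + real n powr (\<gamma> - 1))"
      "Im (ur n) - Im (ll n) = \<kappa> * real n powr (\<gamma> - 1)"
      by (simp_all add: ur_def ll_def algebra_simps)
    have "cmod ?J = cmod (contour_integral (\<Gamma> n) ?f)"
      using contour_integral_unique[OF J] by simp
    also have "\<dots> \<le> 2 * B * ((Re (ur n) - Re (ll n)) + (Im (ur n) - Im (ll n)))"
      unfolding Gamma_eq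
    proof (rule rectpath_contour_integral_bound)
      show "?f contour_integrable_on rectpath (ll n) (ur n)"
        using J by (auto simp: contour_integrable_on_def Gamma_eq)
      show "0 \<le> B" using C c[OF n2(2) k] by (simp add: B_def)
      show "cmod (?f z) \<le> B" if "z \<in> path_image (rectpath (ll n) (ur n))" for z
        unfolding B_def using that n R k by (intro le) (auto simp: Gamma_eq)
      show "Re (ll n) \<le> Re (ur n)" "Im (ll n) \<le> Im (ur n)"
        using mu_in_box[OF n2(1)] by (auto simp: in_box_complex_iff)
    qed
    also have "\<dots> \<le> 2 * B * (P * real n powr (\<gamma> - 1))"
    proof (rule mult_left_mono)
      have "\<kappa> / 2 * ((real n - 1) powr (\<gamma> - 1) + real n powr (\<gamma> - 1)) \<le>
          \<kappa> / 2 * (2 powr \<bar>\<gamma> - 1\<bar> * real n powr (\<gamma> - 1) + real n powr (\<gamma> - 1))"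
        using powr_pred_le(1)[OF n2(1), of "\<gamma> - 1"] kappa_pos by (intro mult_left_mono) auto
      then show "(Re (ur n) - Re (ll n)) + (Im (ur n) - Im (ll n)) \<le> P * real n powr (\<gamma> - 1)"
        unfolding ll_ur P_def by (simp add: algebra_simps)
      show "0 \<le> 2 * B" using C c[OF n2(2) k] by (simp add: B_def)
    qed
    also have "\<dots> = 2 * (C * P * real n powr (- \<alpha>) * real k powr (- \<alpha>) / cdist n k) *
        (real n powr (1 - \<gamma>) * real n powr (\<gamma> - 1))"
      by (simp add: B_def)
    also have "real n powr (1 - \<gamma>) * real n powr (\<gamma> - 1) = 1"
      using n2 by (simp flip: powr_add)
    finally have J_le: "cmod ?J \<le> 2 * (C * P * real n powr (- \<alpha>) * real k powr (- \<alpha>) / cdist n k)"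
      by simp
    have "cinner (p - \<psi> n) (\<psi> k) = 1 / (2 * complex_of_real pi * \<i>) * ?J"
      using psi_orth[of n k] n2 k unfolding p cinner_diff_left
      by (auto simp: cinner_scaleC_left I_def right_diff_distrib)
    then have "cmod (cinner (p - \<psi> n) (\<psi> k)) = cmod ?J / (2 * pi)"
      by (simp add: norm_mult norm_divide)
    \<comment> \<open>Division by 2 pi is weakened to division by 2, just enough to cancel the 2 in
      front of half the perimeter.\<close>
    also have "\<dots> \<le> cmod ?J / 2"
      using pi_gt3 by (intro divide_left_mono) auto
    finally show "cmod (cinner (p - \<psi> n) (\<psi> k)) \<le>
        C * P * real n powr (- \<alpha>) * real k powr (- \<alpha>) / cdist n k" using J_le by simp
  qed
qed

text \<open>Multiplying the squared coefficient bound by \<open>\<mu> k\<close> and summing gives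
  the kernel energy. The bound \<open>B\<close> stays a parameter so that the null-sequence rate and
  the summable rate can both be inserted.\<close>

lemma projection_form_norm_le:
  obtains C N\<^sub>1 where "0 < C" "2 * N\<^sub>0 \<le> N\<^sub>1"
    "\<And>n R p B. N\<^sub>1 \<le> n \<Longrightarrow> riesz_projection n R p \<Longrightarrow>
      \<forall>F. finite F \<longrightarrow> F \<subseteq> {1..} \<longrightarrow> kern_energy \<alpha> \<gamma> F n \<le> B \<Longrightarrow>
      (form_norm a (p - \<psi> n))\<^sup>2 \<le> \<mu> n * (C * B)"
proof -
  obtain C N\<^sub>1 where C: "0 < C" and N1: "2 * N\<^sub>0 \<le> N\<^sub>1" and le:
    "\<And>n R p k. N\<^sub>1 \<le> n \<Longrightarrow> riesz_projection n R p \<Longrightarrow> 1 \<le> k \<Longrightarrow> cmod (cinner (p - \<psi> n) (\<psi> k)) \<le>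
        C * real n powr (- \<alpha>) * real k powr (- \<alpha>) / cdist n k"
    using projection_coefficient_le by metis
  obtain c where c: "0 < c"
    "\<And>n k. 2 * N\<^sub>0 \<le> n \<Longrightarrow> 1 \<le> k \<Longrightarrow> 0 < cdist n k"
    "\<And>n k. 2 * N\<^sub>0 \<le> n \<Longrightarrow> 1 \<le> k \<Longrightarrow> 1 / cdist n k \<le> c * kern \<gamma> n k"
    "\<And>n k. 2 * N\<^sub>0 \<le> n \<Longrightarrow> 1 \<le> k \<Longrightarrow> \<mu> k \<le> \<mu> n + 2 * cdist n k"
    "\<And>n. 2 * N\<^sub>0 \<le> n \<Longrightarrow> real n powr \<gamma> \<le> c * \<mu> n"
    using cdist_bounds by metis
  show thesis
  proof (rule that)
    show "0 < C\<^sup>2 * (2 * c\<^sup>2)" "2 * N\<^sub>0 \<le> N\<^sub>1" using C c(1) N1 by auto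
    fix n :: nat and R p and B :: real
    assume n: "N\<^sub>1 \<le> n" and proj: "riesz_projection n R p"
      and B: "\<forall>F. finite F \<longrightarrow> F \<subseteq> {1..} \<longrightarrow> kern_energy \<alpha> \<gamma> F n \<le> B"
    have n2: "1 \<le> n" "2 * N\<^sub>0 \<le> n" using n N1 N0_pos by auto
    have pV: "p \<in> V" using proj unfolding riesz_projection_def by blast
    \<comment> \<open>Lets \<open>\<mu> n\<close> be factored out of the term linear in the kernel,
      at the price of a factor of order n powr (- \<gamma>).\<close>
    have inv_mu: "1 \<le> \<mu> n * (c * real n powr (- \<gamma>))"
    proof -
      have "real n powr (- \<gamma>) * real n powr \<gamma> \<le> real n powr (- \<gamma>) * (c * \<mu> n)"
        by (intro mult_left_mono c(5) n2) auto
      then show ?thesis using n2 by (simp add: mult_ac flip: powr_add)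
    qed
    show "(form_norm a (p - \<psi> n))\<^sup>2 \<le> \<mu> n * (C\<^sup>2 * (2 * c\<^sup>2) * B)"
    proof (rule form_norm_le)
      show "p - \<psi> n \<in> V" by (intro complex_vector.subspace_diff subspace_V pV psi_in_V n2)
      fix F :: "nat set" assume F: "finite F" "F \<subseteq> {1..}"
      let ?e = "\<lambda>k. real n powr (- 2 * \<alpha>) * real k powr (- 2 * \<alpha>) * (kern \<gamma> n k)\<^sup>2"
      let ?g = "\<lambda>k. real n powr (- 2 * \<alpha> - \<gamma>) * (real k powr (- 2 * \<alpha>) * kern \<gamma> n k)"
      have "(\<Sum>k\<in>F. \<mu> k * (cmod (cinner (p - \<psi> n) (\<psi> k)))\<^sup>2) \<le>
          (\<Sum>k\<in>F. \<mu> n * (C\<^sup>2 * (2 * c\<^sup>2)) * (?e k + ?g k))"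
      proof (rule sum_mono)
        fix k assume "k \<in> F"
        then have k: "1 \<le> k" using F by auto
        define D q where "D = 1 / cdist n k" and "q = c * kern \<gamma> n k"
        have D: "0 < D" "D \<le> q" using c(2,3)[OF n2(2) k] by (auto simp: D_def q_def)
        let ?y = "real n powr (- \<alpha>) * real k powr (- \<alpha>)"
        have sq: "(real m powr (- \<alpha>))\<^sup>2 = real m powr (- 2 * \<alpha>)" for m
          by (simp add: power2_eq_square flip: powr_add)
        have y: "?y\<^sup>2 = real n powr (- 2 * \<alpha>) * real k powr (- 2 * \<alpha>)"
          unfolding power_mult_distrib by (simp only: sq)
        have "cmod (cinner (p - \<psi> n) (\<psi> k)) \<le> C * ?y * D"
          using le[OF n proj k] by (simp add: D_def mult.assoc)
        then have "\<mu> k * (cmod (cinner (p - \<psi> n) (\<psi> k)))\<^sup>2 \<le> \<mu> k * (C * ?y * D)\<^sup>2"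
          using mu_gt_0[OF k] by (intro mult_left_mono power_mono) auto
        also have "\<dots> = C\<^sup>2 * ?y\<^sup>2 * (\<mu> k * D\<^sup>2)"
          by (simp add: power_mult_distrib)
        also have "\<dots> \<le> C\<^sup>2 * ?y\<^sup>2 * (\<mu> n * (2 * (c\<^sup>2 * (kern \<gamma> n k)\<^sup>2)) +
            \<mu> n * (2 * (c\<^sup>2 * (real n powr (- \<gamma>) * kern \<gamma> n k))))"
        proof (rule mult_left_mono)
          \<comment> \<open>With \<open>D\<close> the reciprocal distance, the excess of
            \<open>\<mu> k\<close> over \<open>\<mu> n\<close> cancels one power of
            \<open>D\<close>. What remains is one quadratic and one linear term, matching the two
            sums of \<open>kern_energy\<close>.\<close>
          have "\<mu> k * D\<^sup>2 \<le> (\<mu> n + 2 * cdist n k) * D\<^sup>2"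
            by (intro mult_right_mono c(4) n2 k) auto
          also have "\<dots> = \<mu> n * D\<^sup>2 + 2 * D"
            using c(2)[OF n2(2) k] by (simp add: D_def power2_eq_square field_simps)
          also have "\<dots> \<le> \<mu> n * q\<^sup>2 + 2 * q"
            using D mu_gt_0[OF n2(1)] by (intro add_mono mult_left_mono power_mono) auto
          also have "\<dots> \<le> \<mu> n * (2 * (c\<^sup>2 * (kern \<gamma> n k)\<^sup>2)) +
              \<mu> n * (2 * (c\<^sup>2 * (real n powr (- \<gamma>) * kern \<gamma> n k)))"
          proof (rule add_mono)
            show "\<mu> n * q\<^sup>2 \<le> \<mu> n * (2 * (c\<^sup>2 * (kern \<gamma> n k)\<^sup>2))"
              using mu_gt_0[OF n2(1)] by (intro mult_left_mono) (auto simp: q_def power_mult_distrib)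
            show "2 * q \<le> \<mu> n * (2 * (c\<^sup>2 * (real n powr (- \<gamma>) * kern \<gamma> n k)))"
              using mult_right_mono[OF inv_mu, of "2 * q"] D
              by (simp add: q_def power2_eq_square mult_ac)
          qed
          finally show "\<mu> k * D\<^sup>2 \<le> \<mu> n * (2 * (c\<^sup>2 * (kern \<gamma> n k)\<^sup>2)) +
            \<mu> n * (2 * (c\<^sup>2 * (real n powr (- \<gamma>) * kern \<gamma> n k)))" .
        qed simp
        also have "\<dots> =
          \<mu> n * (C\<^sup>2 * (2 * c\<^sup>2)) * (?y\<^sup>2 * (kern \<gamma> n k)\<^sup>2 + ?y\<^sup>2 * (real n powr (- \<gamma>) * kern \<gamma> n k))"
          by (simp add: algebra_simps)
        also have "?y\<^sup>2 * (kern \<gamma> n k)\<^sup>2 + ?y\<^sup>2 * (real n powr (- \<gamma>) * kern \<gamma> n k) = ?e k + ?g k"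
          unfolding y by (simp add: powr_diff powr_minus divide_inverse)
        finally show "\<mu> k * (cmod (cinner (p - \<psi> n) (\<psi> k)))\<^sup>2 \<le>
          \<mu> n * (C\<^sup>2 * (2 * c\<^sup>2)) * (?e k + ?g k)" .
      qed
      also have "\<dots> = \<mu> n * (C\<^sup>2 * (2 * c\<^sup>2)) * kern_energy \<alpha> \<gamma> F n"
        by (simp add: kern_energy_def sum.distrib flip: sum_distrib_left)
      also have "\<dots> \<le> \<mu> n * (C\<^sup>2 * (2 * c\<^sup>2)) * B"
        using mu_gt_0[OF n2(1)] B F by (intro mult_left_mono) auto
      finally show "(\<Sum>k\<in>F. \<mu> k * (cmod (cinner (p - \<psi> n) (\<psi> k)))\<^sup>2) \<le>
          \<mu> n * (C\<^sup>2 * (2 * c\<^sup>2) * B)" by (simp add: mult.assoc)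
    qed
  qed
qed

end

section \<open>From the operator T to the limits and quadratic closeness\<close>

lemma resolvent_set_solution:
  assumes T: "T = form_operator V s" and z: "z \<in> resolvent_set T"
  shows "resolvent T z x \<in> V"
    "v \<in> V \<Longrightarrow> s (resolvent T z x) v = z * cinner (resolvent T z x) v - cinner x v"
proof -
  have "\<exists>!u. \<exists>w. (u, w) \<in> T \<and> z *\<^sub>C u - w = x" using z by (simp add: resolvent_set_def)
  then have "\<exists>w. (resolvent T z x, w) \<in> T \<and> z *\<^sub>C resolvent T z x - w = x"
    unfolding resolvent_def by (rule theI')
  then obtain w where w: "(resolvent T z x, w) \<in> T" "z *\<^sub>C resolvent T z x - w = x" by blast
  then have "w = z *\<^sub>C resolvent T z x - x" by (metis diff_diff_eq2 add_diff_cancel_left')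
  then show "resolvent T z x \<in> V"
    "v \<in> V \<Longrightarrow> s (resolvent T z x) v = z * cinner (resolvent T z x) v - cinner x v"
    using w(1) by (auto simp: T form_operator_def cinner_diff_left cinner_scaleC_left)
qed

theorem lemmaA10:
  fixes V :: "'a::complex_hilbert_space set"
    and a b :: "'a \<Rightarrow> 'a \<Rightarrow> complex"
    and A T :: "'a op_graph"
    and \<mu> :: "nat \<Rightarrow> real" and \<psi> :: "nat \<Rightarrow> 'a"
    and \<gamma> \<kappa> \<alpha> M\<^sub>b :: real and N\<^sub>0 N :: nat
    and lam :: "nat \<Rightarrow> complex" and \<phi> :: "nat \<Rightarrow> 'a"
  assumes separable: "separable_space (euclidean :: 'a topology)"
    and infinite_dim: "\<nexists>B :: 'a set. finite B \<and> cspan B = UNIV"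
    and a_form: "sesquilinear_on V a" "closure V = UNIV" "hermitian_on V a"
      "positive_definite_on V a" "closed_form_on V a"
    and A_def: "A = form_operator V a"
    and A_compact: "compact_resolvent A"
    and \<mu>_pos_mono: "0 < \<mu> 1" "mono_on {1..} \<mu>"
    and \<psi>_basis: "orthonormal_basis \<psi>"
    and \<psi>_eigen: "\<And>k. 1 \<le> k \<Longrightarrow> eigenvector A (complex_of_real (\<mu> k)) (\<psi> k)"
    and b_form: "sesquilinear_on V b"
    and b_cont: "\<exists>C. \<forall>u\<in>V. \<forall>v\<in>V. cmod (b u v) \<le> C * form_norm a u * form_norm a v"
    and positivity: "0 < \<gamma>" "0 < \<kappa>" "0 < N\<^sub>0" "0 < M\<^sub>b"
    and gap: "\<And>k. N\<^sub>0 \<le> k \<Longrightarrow> \<kappa> * real k powr (\<gamma> - 1) \<le> \<mu> (Suc k) - \<mu> k"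
    and \<alpha>\<gamma>: "1 < 2 * \<alpha> + \<gamma>"
    and b_bound: "\<And>m n. 1 \<le> m \<Longrightarrow> 1 \<le> n \<Longrightarrow>
      cmod (b (\<psi> m) (\<psi> n)) \<le> M\<^sub>b * real m powr (- \<alpha>) * real n powr (- \<alpha>)"
    and T_def: "T = form_operator V (\<lambda>u v. a u v + b u v)"
    and N_pos: "1 \<le> N"
    and contour: "\<And>n. N < n \<Longrightarrow> path_image (Gamma_path \<mu> \<kappa> \<gamma> n) \<subseteq> resolvent_set T"
    and lam_unique: "\<And>n. N < n \<Longrightarrow> eigenvalues T \<inter> Pi_rect \<mu> \<kappa> \<gamma> n = {lam n}"
    and lam_simple: "\<And>n. N < n \<Longrightarrow> algebraically_simple T (lam n)"
    and \<phi>_integral: "\<And>n. N < n \<Longrightarrow>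
      \<phi> n = (1 / (2 * complex_of_real pi * \<i>)) *\<^sub>C
        vector_contour_integral (Gamma_path \<mu> \<kappa> \<gamma> n) (\<lambda>z. resolvent T z (\<psi> n))"
    and \<phi>_eigen: "\<And>n. N < n \<Longrightarrow> eigenvector T (lam n) (\<phi> n)"
    and \<phi>_root: "\<And>n. 1 \<le> n \<Longrightarrow> n \<le> N \<Longrightarrow>
      \<phi> n \<noteq> 0 \<and> (\<exists>\<zeta>\<in>eigenvalues T - lam ` {N<..}. \<phi> n \<in> root_subspace T \<zeta>)"
    and \<phi>_root_basis: "inj_on \<phi> {1..N}" "cindependent (\<phi> ` {1..N})"
      "cspan (\<phi> ` {1..N}) = cspan (\<Union>\<zeta>\<in>eigenvalues T - lam ` {N<..}. root_subspace T \<zeta>)"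
  shows "(\<lambda>j. sqrt (cmod (lam j)) / sqrt (\<mu> j)) \<longlonglongrightarrow> 1 \<and>
    (\<lambda>j. sqrt (cmod (lam j)) / form_norm a (\<phi> j)) \<longlonglongrightarrow> 1 \<and>
    ((\<alpha> \<le> 1 \<longrightarrow> 3 / 2 < 2 * \<alpha> + \<gamma>) \<and> (1 < \<alpha> \<longrightarrow> 1 < 2 * \<alpha> + \<gamma>) \<longrightarrow>
      quadratically_close (form_norm a)
        (\<lambda>j. (1 / form_norm a (\<phi> j)) *\<^sub>R \<phi> j)
        (\<lambda>j. (1 / sqrt (\<mu> j)) *\<^sub>R \<psi> j))"
proof -
  have psi: "\<psi> k \<in> V" "\<And>v. v \<in> V \<Longrightarrow> a (\<psi> k) v = \<mu> k * cinner (\<psi> k) v" if "1 \<le> k" for k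
    using \<psi>_eigen[OF that] unfolding A_def eigenvector_def form_operator_def
    by (auto simp: cinner_scaleC_left)
  interpret perturbed_form \<mu> \<gamma> \<kappa> N\<^sub>0 V a b \<psi> \<alpha> M\<^sub>b
    by unfold_locales (fact assms psi)+
  obtain c where c: "0 < c" "\<And>n. 2 * N\<^sub>0 \<le> n \<Longrightarrow> real n powr \<gamma> \<le> c * \<mu> n"
    using cdist_bounds by metis

  \<comment> \<open>The eigenvector property provides both membership in \<open>V\<close> and
    nonvanishing of \<open>\<phi> n\<close>; only indices above \<open>N\<close> enter, which is
    enough for limits and for summability.\<close>
  have proj: "riesz_projection n (\<lambda>z. resolvent T z (\<psi> n)) (\<phi> n)" if n: "N < n" for n
  proof -
    have "(\<phi> n, lam n *\<^sub>C \<phi> n) \<in> T" "\<phi> n \<noteq> 0"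
      using \<phi>_eigen[OF n] by (auto simp: eigenvector_def)
    moreover have "resolvent_eq n z (resolvent T z (\<psi> n))" if "z \<in> path_image (\<Gamma> n)" for z
    proof -
      have "z \<in> resolvent_set T" using contour[OF n] that by blast
      then show ?thesis
        unfolding resolvent_eq_def using resolvent_set_solution[OF T_def] by blast
    qed
    ultimately show ?thesis
      using \<phi>_integral[OF n] unfolding riesz_projection_def T_def form_operator_def by blast
  qed
  have phi: "\<phi> n \<in> V" "\<phi> n \<noteq> 0" if "N < n" for n
    using proj[OF that] unfolding riesz_projection_def by blast+

  have psi_norm: "form_norm a (\<psi> n) = sqrt (\<mu> n)" "\<psi> n \<noteq> 0"
    if "1 \<le> n" for n
  proof -
    have "Re (a (\<psi> n) (\<psi> n)) = \<mu> n" using psi[OF that] psi_orth[OF that that] by simp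
    then show "form_norm a (\<psi> n) = sqrt (\<mu> n)" by (simp add: form_norm_def)
    show "\<psi> n \<noteq> 0" using \<psi>_eigen[OF that] by (simp add: eigenvector_def)
  qed

  \<comment> \<open>The relative error in the form norm, because \<open>\<psi> n\<close> has form
    norm \<open>sqrt (\<mu> n)\<close>.\<close>
  define E where "E n = form_norm a (\<phi> n - \<psi> n) / sqrt (\<mu> n)" for n
  obtain C N\<^sub>1 where C: "0 < C" and N1: "2 * N\<^sub>0 \<le> N\<^sub>1" and C_le:
    "\<And>n R p B. N\<^sub>1 \<le> n \<Longrightarrow> riesz_projection n R p \<Longrightarrow>
      \<forall>F. finite F \<longrightarrow> F \<subseteq> {1..} \<longrightarrow> kern_energy \<alpha> \<gamma> F n \<le> B \<Longrightarrow> (form_norm a (p - \<psi> n))\<^sup>2 \<le> \<mu> n * (C * B)"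
    using projection_form_norm_le by metis
  define N\<^sub>2 where "N\<^sub>2 = max N\<^sub>1 (Suc N)"
  have N2: "N\<^sub>1 \<le> n" "N < n" "1 \<le> n" "2 * N\<^sub>0 \<le> n" if "N\<^sub>2 \<le> n" for n
    using that N1 N0_pos by (auto simp: N\<^sub>2_def)
  have E_le: "(E n)\<^sup>2 \<le> C * B"
    if n: "N\<^sub>2 \<le> n" and B: "\<forall>F. finite F \<longrightarrow> F \<subseteq> {1..} \<longrightarrow> kern_energy \<alpha> \<gamma> F n \<le> B" for n B
  proof -
    have "(form_norm a (\<phi> n - \<psi> n))\<^sup>2 \<le> \<mu> n * (C * B)"
      by (rule C_le[OF N2(1)[OF n] proj[OF N2(2)[OF n]] B])
    then show ?thesis
      using mu_gt_0[of n] N2[OF n] by (simp add: E_def power_divide divide_le_eq mult.commute)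
  qed
  obtain \<epsilon> D where \<epsilon>: "0 < \<epsilon>" and D: "\<forall>n\<ge>1. \<forall>F. finite F \<longrightarrow> F \<subseteq> {1..} \<longrightarrow>
      kern_energy \<alpha> \<gamma> F n \<le> D * real n powr (- \<epsilon>)"
    and summ: "3 / 2 < 2 * \<alpha> + \<gamma> \<Longrightarrow> \<exists>\<delta>>0. \<exists>D. \<forall>n\<ge>1. \<forall>F. finite F \<longrightarrow> F \<subseteq> {1..} \<longrightarrow>
      kern_energy \<alpha> \<gamma> F n \<le> D * real n powr (- (1 + \<delta>))"
    using kern_energy_le[OF gamma_pos alpha_gamma] by metis

  have E_lim: "E \<longlonglongrightarrow> 0"
  proof -
    have "(\<lambda>n. C * (D * real n powr (- \<epsilon>))) \<longlonglongrightarrow> C * (D * 0)"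
      using \<epsilon> by (intro tendsto_intros tendsto_neg_powr filterlim_real_sequentially) auto
    then have lim: "(\<lambda>n. C * (D * real n powr (- \<epsilon>))) \<longlonglongrightarrow> 0" by simp
    have "\<forall>\<^sub>F n in sequentially. (E n)\<^sup>2 \<le> C * (D * real n powr (- \<epsilon>))"
      unfolding eventually_sequentially
      using E_le D N2(3) by (intro exI[of _ N\<^sub>2] allI impI) blast
    then have "(\<lambda>n. (E n)\<^sup>2) \<longlonglongrightarrow> 0"
      by (intro tendsto_sandwich[OF _ _ tendsto_const lim]) auto
    then have "(\<lambda>n. sqrt ((E n)\<^sup>2)) \<longlonglongrightarrow> sqrt 0" by (intro tendsto_intros)
    then show ?thesis by (simp add: tendsto_rabs_zero_iff)
  qed

  have lam_lim: "(\<lambda>n. lam n / \<mu> n) \<longlonglongrightarrow> 1"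
  proof -
    \<comment> \<open>The eigenvalue lies in a rectangle around \<open>\<mu> n\<close> of size of
      order n powr (\<gamma> - 1), while \<open>\<mu> n\<close> is at least of order n powr
      \<gamma>; the relative error is therefore of order 1/n.\<close>
    define P where "P = \<kappa> * (2 powr \<bar>\<gamma> - 1\<bar> + 2) * c"
    have bound: "norm (lam n / \<mu> n - 1) \<le> P * real n powr (- 1)" if n: "N\<^sub>2 \<le> n" for n
    proof -
      let ?x = "real n powr (\<gamma> - 1)"
      have n2: "2 \<le> n" "1 \<le> n" using N2[OF n] N0_pos by auto
      have "lam n \<in> Pi_rect \<mu> \<kappa> \<gamma> n" using lam_unique[OF N2(2)[OF n]] by blast
      then have box: "\<mu> n - \<kappa> / 2 * (real n - 1) powr (\<gamma> - 1) < Re (lam n)"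
        "Re (lam n) < \<mu> n + \<kappa> / 2 * ?x" "\<bar>Im (lam n)\<bar> < \<kappa> / 2 * ?x"
        by (auto simp: Pi_rect_def)
      have "cmod (lam n - \<mu> n) \<le> \<bar>Re (lam n - \<mu> n)\<bar> + \<bar>Im (lam n - \<mu> n)\<bar>" by (rule cmod_le)
      also have "\<dots> \<le> \<kappa> / 2 * ((real n - 1) powr (\<gamma> - 1) + ?x) + \<kappa> / 2 * ?x"
      proof -
        have "0 \<le> \<kappa> * (real n - 1) powr (\<gamma> - 1)" "0 \<le> \<kappa> * ?x" using kappa_pos by auto
        then show ?thesis using box by (simp add: distrib_left)
      qed
      also have "\<dots> \<le> \<kappa> / 2 * (2 powr \<bar>\<gamma> - 1\<bar> * ?x + ?x) + \<kappa> / 2 * ?x"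
        using powr_pred_le(1)[OF n2(1), of "\<gamma> - 1"] kappa_pos
        by (intro add_mono mult_left_mono) auto
      also have "\<dots> \<le> \<kappa> * (2 powr \<bar>\<gamma> - 1\<bar> + 2) * ?x"
        using kappa_pos by (simp add: algebra_simps)
      also have "\<dots> = \<kappa> * (2 powr \<bar>\<gamma> - 1\<bar> + 2) * (real n powr (- 1) * real n powr \<gamma>)"
        using n2 by (simp add: powr_diff powr_minus divide_inverse)
      also have "\<dots> \<le> \<kappa> * (2 powr \<bar>\<gamma> - 1\<bar> + 2) * (real n powr (- 1) * (c * \<mu> n))"
        using kappa_pos by (intro mult_left_mono c(2) N2(4)[OF n]) auto
      finally have "cmod (lam n - \<mu> n) \<le> P * real n powr (- 1) * \<mu> n"
        by (simp add: P_def mult_ac)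
      moreover have "lam n / \<mu> n - 1 = (lam n - \<mu> n) / \<mu> n"
        using mu_gt_0[OF n2(2)] by (simp add: diff_divide_distrib)
      ultimately show ?thesis
        using mu_gt_0[OF n2(2)] by (simp add: norm_divide pos_divide_le_eq)
    qed
    have lim: "(\<lambda>n. P * real n powr (- 1)) \<longlonglongrightarrow> P * 0"
      by (intro tendsto_intros tendsto_neg_powr filterlim_real_sequentially) auto
    have "\<forall>\<^sub>F n in sequentially. norm (lam n / \<mu> n - 1) \<le> P * real n powr (- 1)"
      unfolding eventually_sequentially using bound by blast
    then have "(\<lambda>n. lam n / \<mu> n - 1) \<longlonglongrightarrow> 0"
      by (rule Lim_null_comparison) (use lim in \<open>simp only: mult_zero_right\<close>)
    then show ?thesis by (rule LIM_zero_cancel)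
  qed
  have abs_mu: "\<bar>\<mu> n\<bar> = \<mu> n" if "1 \<le> n" for n using mu_gt_0[OF that] by simp
  have lim1: "(\<lambda>j. sqrt (cmod (lam j)) / sqrt (\<mu> j)) \<longlonglongrightarrow> 1"
  proof -
    have "(\<lambda>n. sqrt (cmod (lam n / \<mu> n))) \<longlonglongrightarrow> sqrt (cmod 1)"
      by (intro tendsto_intros lam_lim)
    moreover have "\<forall>\<^sub>F n in sequentially. sqrt (cmod (lam n / \<mu> n)) = sqrt (cmod (lam n)) / sqrt (\<mu> n)"
      using eventually_ge_at_top[of 1]
      by eventually_elim (simp add: norm_divide real_sqrt_divide abs_mu)
    ultimately show ?thesis by (simp add: tendsto_cong)
  qed

  have diff: "\<bar>form_norm a (\<phi> n) / sqrt (\<mu> n) - 1\<bar> \<le> E n"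
    "form_norm a ((1 / form_norm a (\<phi> n)) *\<^sub>R \<phi> n - (1 / sqrt (\<mu> n)) *\<^sub>R \<psi> n) \<le> 2 * E n"
    if n: "N\<^sub>2 \<le> n" for n
  proof -
    note n' = N2(2,3)[OF n]
    note le = form_norm_normalized_diff_le[OF a_sesq a_herm a_pos phi(1)[OF n'(1)] psi(1)[OF n'(2)]
      phi(2)[OF n'(1)] psi_norm(2)[OF n'(2)]]
    show "form_norm a ((1 / form_norm a (\<phi> n)) *\<^sub>R \<phi> n - (1 / sqrt (\<mu> n)) *\<^sub>R \<psi> n) \<le> 2 * E n"
      using le(1) by (simp add: E_def psi_norm(1)[OF n'(2)])
    have s: "0 < sqrt (\<mu> n)" using mu_gt_0[OF n'(2)] by simp
    have "form_norm a (\<phi> n) / sqrt (\<mu> n) - 1 = (form_norm a (\<phi> n) - sqrt (\<mu> n)) / sqrt (\<mu> n)"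
      using s by (simp add: diff_divide_distrib)
    then show "\<bar>form_norm a (\<phi> n) / sqrt (\<mu> n) - 1\<bar> \<le> E n"
      using le(2) s by (simp add: E_def psi_norm(1)[OF n'(2)] divide_right_mono)
  qed
  have "\<forall>\<^sub>F n in sequentially. norm (form_norm a (\<phi> n) / sqrt (\<mu> n) - 1) \<le> E n"
    unfolding eventually_sequentially real_norm_def using diff(1) by blast
  then have "(\<lambda>n. form_norm a (\<phi> n) / sqrt (\<mu> n) - 1) \<longlonglongrightarrow> 0"
    by (rule Lim_null_comparison[OF _ E_lim])
  then have "(\<lambda>n. form_norm a (\<phi> n) / sqrt (\<mu> n)) \<longlonglongrightarrow> 1" by (rule LIM_zero_cancel)
  \<comment> \<open>The second limit is the quotient of the first one and of the limit of normalised
    form norms; the square roots of \<open>\<mu> n\<close> cancel.\<close>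
  then have "(\<lambda>n. (sqrt (cmod (lam n)) / sqrt (\<mu> n)) / (form_norm a (\<phi> n) / sqrt (\<mu> n))) \<longlonglongrightarrow> 1 / 1"
    by (intro tendsto_divide lim1) auto
  moreover have "\<forall>\<^sub>F n in sequentially.
      (sqrt (cmod (lam n)) / sqrt (\<mu> n)) / (form_norm a (\<phi> n) / sqrt (\<mu> n)) =
      sqrt (cmod (lam n)) / form_norm a (\<phi> n)"
    using eventually_ge_at_top[of 1]
    by eventually_elim (use mu_gt_0 in \<open>force simp: divide_simps\<close>)
  ultimately have "(\<lambda>j. sqrt (cmod (lam j)) / form_norm a (\<phi> j)) \<longlonglongrightarrow> 1 / 1"
    by (rule Lim_transform_eventually)
  then have lim2: "(\<lambda>j. sqrt (cmod (lam j)) / form_norm a (\<phi> j)) \<longlonglongrightarrow> 1" by simp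

  have quad: "quadratically_close (form_norm a)
      (\<lambda>j. (1 / form_norm a (\<phi> j)) *\<^sub>R \<phi> j) (\<lambda>j. (1 / sqrt (\<mu> j)) *\<^sub>R \<psi> j)"
    if large: "3 / 2 < 2 * \<alpha> + \<gamma>"
  proof -
    let ?q = "\<lambda>n. (form_norm a ((1 / form_norm a (\<phi> n)) *\<^sub>R \<phi> n - (1 / sqrt (\<mu> n)) *\<^sub>R \<psi> n))\<^sup>2"
    obtain \<delta> D' where \<delta>: "0 < \<delta>" and D': "\<forall>n\<ge>1. \<forall>F. finite F \<longrightarrow> F \<subseteq> {1..} \<longrightarrow>
      kern_energy \<alpha> \<gamma> F n \<le> D' * real n powr (- (1 + \<delta>))"
      using summ[OF large] by blast
    have scaleR: "r *\<^sub>R w \<in> V" if "w \<in> V" for r :: real and w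
      using complex_vector.subspace_scale[OF subspace_V that] by (simp add: scaleR_scaleC)
    have q_le: "norm (?q n) \<le> 4 * (C * D') * real n powr (- (1 + \<delta>))" if n: "N\<^sub>2 \<le> n" for n
    proof -
      have "norm (?q n) = ?q n" by simp
      also have "\<dots> \<le> (2 * E n)\<^sup>2"
        using N2[OF n]
        by (intro power_mono diff(2) n form_norm_power2(2)[OF a_sesq a_pos]
            complex_vector.subspace_diff[OF subspace_V] scaleR phi psi) auto
      also have "\<dots> \<le> 4 * (C * (D' * real n powr (- (1 + \<delta>))))"
        using E_le[OF n D'[THEN spec, THEN mp, OF N2(3)[OF n]]] by simp
      finally show ?thesis by (simp add: mult.assoc)
    qed
    have "summable (\<lambda>n. 4 * (C * D') * real n powr (- (1 + \<delta>)))"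
      using \<delta> by (intro summable_mult) (simp add: summable_real_powr_iff)
    then have "summable ?q"
      using q_le by (rule summable_comparison_test')
    \<comment> \<open>The comparison holds only from \<open>N\<^sub>2\<close> on, which suffices for
      the series. Nonnegativity turns its convergence into unordered summability, which is then
      restricted to the positive indices.\<close>
    then have "?q summable_on UNIV"
      by (subst summable_on_UNIV_nonneg_real_iff) simp_all
    then show ?thesis
      unfolding quadratically_close_def by (rule summable_on_subset_banach) auto
  qed
  \<comment> \<open>The two cases merge: for \<alpha> > 1 the sum already exceeds 2.\<close>
  have "3 / 2 < 2 * \<alpha> + \<gamma>"
    if "(\<alpha> \<le> 1 \<longrightarrow> 3 / 2 < 2 * \<alpha> + \<gamma>) \<and> (1 < \<alpha> \<longrightarrow> 1 < 2 * \<alpha> + \<gamma>)"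
    using that gamma_pos by (cases "\<alpha> \<le> 1") auto
  then show ?thesis using lim1 lim2 quad by blast
qed

end
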